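(* There exists a reduced quasiconformal mapping $f\colon\mathbb{C}\to\mathbb{C}$ whose restriction to the segment $[0,1]$ has infinite $\Phi_q$-variation for every $0<q<1$, i.e. $\sup\sum_{j=1}^N\Phi_q(|f(x_j)-f(x_{j-1})|)=\infty$, the supremum over all $N\ge1$ and all partitions $0=x_0<\dots<x_N=1$.
   Context: A nonconstant continuous mapping $f\colon\mathbb{C}\to\mathbb{C}$ in $W^{1,2}_{\rm loc}$ is reduced quasiconformal if there is a constant $k\in[0,1)$ with $|f_{\bar z}|\le k\operatorname{Re} f_z$ almost everywhere. For $q>0$, $\Phi_q\colon[0,\infty)\to[0,\infty)$ denotes any convex increasing function with $\Phi_q(t)=t/(\log(1/t))^q$ for all sufficiently small $t>0$. A function $v$ on $[a,b]$ has finite $\Phi$-variation if $\sup\sum_{j=1}^N\Phi(|v(x_j)-v(x_{j-1})|)<\infty$ over all partitions $a=x_0<\dots<x_N=b$, $N\ge1$. *)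

theory Defs
  imports "HOL-Analysis.Analysis"
begin

definition dirderiv :: "(complex \<Rightarrow> real) \<Rightarrow> complex \<Rightarrow> complex \<Rightarrow> real" where
  "dirderiv \<phi> v z = frechet_derivative \<phi> (at z) v"

fun Ck_fun :: "nat \<Rightarrow> (complex \<Rightarrow> real) \<Rightarrow> bool" where
  "Ck_fun 0 \<phi> = continuous_on UNIV \<phi>"
| "Ck_fun (Suc n) \<phi> = (continuous_on UNIV \<phi> \<and> (\<forall>z. \<phi> differentiable (at z)) \<and>
      Ck_fun n (dirderiv \<phi> 1) \<and> Ck_fun n (dirderiv \<phi> \<i>))"

definition smooth_fun :: "(complex \<Rightarrow> real) \<Rightarrow> bool" where
  "smooth_fun \<phi> \<longleftrightarrow> (\<forall>n. Ck_fun n \<phi>)"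

definition test_fun :: "(complex \<Rightarrow> real) \<Rightarrow> bool" where
  "test_fun \<phi> \<longleftrightarrow> smooth_fun \<phi> \<and> compact (closure {z. \<phi> z \<noteq> 0})"

definition L2loc :: "(complex \<Rightarrow> complex) \<Rightarrow> bool" where
  "L2loc f \<longleftrightarrow> f \<in> borel_measurable lebesgue \<and>
     (\<forall>K. compact K \<longrightarrow> set_integrable lebesgue K (\<lambda>z. (cmod (f z))\<^sup>2))"

definition weak_partial :: "(complex \<Rightarrow> complex) \<Rightarrow> complex \<Rightarrow> (complex \<Rightarrow> complex) \<Rightarrow> bool" where
  "weak_partial f v g \<longleftrightarrow> (\<forall>\<phi>. test_fun \<phi> \<longrightarrow>
     integral\<^sup>L lebesgue (\<lambda>z. complex_of_real (dirderiv \<phi> v z) * f z)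
       = - integral\<^sup>L lebesgue (\<lambda>z. complex_of_real (\<phi> z) * g z))"

definition W12loc :: "(complex \<Rightarrow> complex) \<Rightarrow> bool" where
  "W12loc f \<longleftrightarrow> L2loc f \<and> (\<exists>gx gy. L2loc gx \<and> L2loc gy \<and>
     weak_partial f 1 gx \<and> weak_partial f \<i> gy)"

text \<open>Reduced quasiconformal: nonconstant, continuous, W^{1,2}_loc, and
  |f_zbar| \<le> k Re f_z a.e. with f_z = (f_x - i f_y)/2, f_zbar = (f_x + i f_y)/2.\<close>
definition reduced_qc :: "(complex \<Rightarrow> complex) \<Rightarrow> bool" where
  "reduced_qc f \<longleftrightarrow> (\<exists>a b. f a \<noteq> f b) \<and> continuous_on UNIV f \<and> W12loc f \<and>
     (\<exists>gx gy k. weak_partial f 1 gx \<and> weak_partial f \<i> gy \<and> 0 \<le> k \<and> k < 1 \<and>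
        (AE z in lebesgue. cmod ((gx z + \<i> * gy z) / 2) \<le> k * Re ((gx z - \<i> * gy z) / 2)))"

definition Phi_q :: "real \<Rightarrow> (real \<Rightarrow> real) \<Rightarrow> bool" where
  "Phi_q q \<Phi> \<longleftrightarrow> convex_on {0..} \<Phi> \<and> mono_on {0..} \<Phi> \<and> (\<forall>t\<ge>0. \<Phi> t \<ge> 0) \<and>
     (\<exists>\<delta>>0. \<forall>t. 0 < t \<and> t < \<delta> \<longrightarrow> \<Phi> t = t / (ln (1 / t)) powr q)"

definition finite_Phi_variation :: "(real \<Rightarrow> real) \<Rightarrow> (real \<Rightarrow> complex) \<Rightarrow> real \<Rightarrow> real \<Rightarrow> bool" where
  "finite_Phi_variation \<Phi> v a b \<longleftrightarrow> (\<exists>B. \<forall>N x. N \<ge> 1 \<and> x 0 = a \<and> x N = b \<and>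
     (\<forall>j<N. x j < x (Suc j)) \<longrightarrow>
       (\<Sum>j<N. \<Phi> (cmod (v (x (Suc j)) - v (x j)))) \<le> B)"

end

theory Submission
  imports Defs "HOL-Real_Asymp.Real_Asymp"
begin

text \<open>Let \<open>v\<close> be a curve over the real line whose second differences are small compared with the
  increments of its real part, \<open>\<bar>v (x + t) - 2 v x + v (x - t)\<bar> \<le> (Re v (x + t) - Re v (x - t)) / 20\<close>.
  Let \<open>V x y\<close> be the mean of \<open>v\<close> over \<open>[x - y, x + y]\<close> with the tent weight. Then
  \<open>V + \<i> y V\<^sub>x\<close> is a reduced quasiconformal extension of \<open>v\<close>: all derivatives of \<open>V\<close> entering
  its Wirtinger derivatives, except \<open>V\<^sub>x\<close> itself, are controlled by second differences of \<open>v\<close>,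
  and \<open>V\<^sub>x\<close> contributes only to the derivative in \<open>z\<close>.

  Such a \<open>v\<close> arises by integrating a complex martingale on 6-adic intervals whose steps are small
  multiples of its (positive) real part \<open>w\<close>. The imaginary part is unconstrained, and it has linearly
  growing mean absolute value because \<open>w\<close> is singular: this is the \<open>L log L\<close> phenomenon for
  conjugate functions. Thus the partition into intervals of length \<open>6^(-n)\<close> has length sum at
  least \<open>c n\<close>, and Jensen's inequality gives a \<open>\<Phi>\<close>-sum of at least a multiple of \<open>n / n powr q\<close>.\<close>

section \<open>Weak derivatives from difference quotients\<close>

text \<open>The extension cannot be Lipschitz, because the curve has infinite length, so square
  integrability of its derivatives must be earned. The factor 1/20 does this: increments of
  \<open>v\<close> shrink by 11/20 under halving, which makes \<open>v\<close> Hoelder with exponent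
  3/4 and the derivatives of order |Im z|^(-1/4), locally in L^2. The same factor gives the
  distortion constant 3/8. Linear growth of the mean of |slope| comes from a potential whose mean
  gains, in each generation, a fixed multiple of the mean of \<open>w\<close>. That mean stays 1, so
  every generation adds the same amount. Steps in both the real and the imaginary direction are
  used, since the gain in either one alone degenerates for some directions of the slope. Together
  with two neutral outer children this makes six children per cell. The inscribed polygon with mesh
  6^(-n) thus has length at least of order log(1/mesh), and n / n^q diverges exactly because q < 1.
  The partitions depend neither on q nor on \<Phi>, so one curve serves all of them.\<close>

lemma dirderiv_has_vector_derivative:
  assumes "\<phi> differentiable (at (z + of_real t * v))"
  shows "((\<lambda>t. \<phi> (z + of_real t * v)) has_vector_derivative dirderiv \<phi> v (z + of_real t * v)) (at t)"
proof -
  have 1: "(\<phi> has_derivative frechet_derivative \<phi> (at (z + of_real t * v))) (at (z + of_real t * v))"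
    using assms frechet_derivative_works by blast
  have 2: "((\<lambda>t. z + of_real t * v) has_derivative (\<lambda>h. of_real h * v)) (at t)"
    by (auto intro!: derivative_eq_intros)
  have lin: "linear (frechet_derivative \<phi> (at (z + of_real t * v)))"
    using 1 has_derivative_linear by blast
  have "((\<lambda>t. \<phi> (z + of_real t * v)) has_derivative
      (\<lambda>h. frechet_derivative \<phi> (at (z + of_real t * v)) (of_real h * v))) (at t)"
    using has_derivative_compose[OF 2 1] .
  moreover have "frechet_derivative \<phi> (at (z + of_real t * v)) (of_real h * v)
      = h *\<^sub>R dirderiv \<phi> v (z + of_real t * v)" for h
    unfolding dirderiv_def using linear_scale[OF lin, of h v] by (simp add: scaleR_conv_of_real)
  ultimately show ?thesis by (simp add: has_vector_derivative_def)
qed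

lemma test_fun_bounds:
  assumes "test_fun \<phi>" and v: "v \<in> {1, \<i>}"
  obtains R M where "continuous_on UNIV \<phi>" "continuous_on UNIV (dirderiv \<phi> v)" "0 \<le> R" "0 \<le> M"
    "\<And>z. \<phi> differentiable (at z)" "\<And>z. R < cmod z \<Longrightarrow> \<phi> z = 0"
    "\<And>z. \<bar>\<phi> z\<bar> \<le> M" "\<And>z. \<bar>dirderiv \<phi> v z\<bar> \<le> M"
proof -
  have "Ck_fun (Suc 0) \<phi>" using assms(1) unfolding test_fun_def smooth_fun_def by blast
  then have c: "continuous_on UNIV \<phi>" and cd: "continuous_on UNIV (dirderiv \<phi> v)"
    and d: "\<And>z. \<phi> differentiable (at z)" using v by auto
  have "bounded (closure {z. \<phi> z \<noteq> 0})" using assms(1) unfolding test_fun_def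
    by (simp add: compact_imp_bounded)
  then have "bounded {z. \<phi> z \<noteq> 0}" using bounded_subset closure_subset by blast
  then obtain R where R: "0 < R" "\<And>z. \<phi> z \<noteq> 0 \<Longrightarrow> cmod z \<le> R"
    using bounded_pos by (metis (mono_tags) mem_Collect_eq)
  have z0: "\<phi> z = 0" if "R < cmod z" for z using R(2)[of z] that by linarith
  have dz0: "dirderiv \<phi> v z = 0" if "R < cmod z" for z
  proof -
    have "open {z. R < cmod z}" by (intro open_Collect_less continuous_intros)
    then have "(\<phi> has_derivative (\<lambda>h. 0)) (at z)"
      by (rule has_derivative_transform_within_open[OF has_derivative_const[of 0]]) (use that z0 in auto)
    then have "frechet_derivative \<phi> (at z) = (\<lambda>h. 0)" using frechet_derivative_at by metis
    then show ?thesis by (simp add: dirderiv_def)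
  qed
  have "compact (\<phi> ` cball 0 R)" "compact (dirderiv \<phi> v ` cball 0 R)"
    by (auto intro!: compact_continuous_image continuous_on_subset[OF c] continuous_on_subset[OF cd])
  then have "bounded (\<phi> ` cball 0 R)" "bounded (dirderiv \<phi> v ` cball 0 R)"
    by (auto simp: compact_imp_bounded)
  then obtain M1 M2 where M: "M1 > 0" "M2 > 0" "\<forall>x\<in>\<phi> ` cball 0 R. norm x \<le> M1"
    "\<forall>x\<in>dirderiv \<phi> v ` cball 0 R. norm x \<le> M2" by (meson bounded_pos)
  have "\<bar>\<phi> z\<bar> \<le> M1 + M2" "\<bar>dirderiv \<phi> v z\<bar> \<le> M1 + M2" for z
    using M z0[of z] dz0[of z] by (cases "cmod z \<le> R"; force)+
  then show ?thesis using that[OF c cd _ _ d z0] R M by (metis add_nonneg_nonneg less_imp_le)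
qed

lemma lborel_integral_shift:
  fixes F :: "complex \<Rightarrow> complex"
  assumes "F \<in> borel_measurable borel"
  shows "(LINT z|lborel. F (c + z)) = (LINT z|lborel. F z)"
proof -
  have "(LINT z|lborel. F z) = (LINT z|distr lborel borel ((+) c). F z)"
    by (simp add: lborel_distr_plus)
  also have "\<dots> = (LINT z|lborel. F (c + z))" using assms by (subst integral_distr) auto
  finally show ?thesis by simp
qed

text \<open>The difference quotient is moved from the test function to \<open>f\<close> by translation invariance of
  Lebesgue measure, so no Fubini argument is required.\<close>
lemma weak_partial_of_difference_quotients:
  fixes f g :: "complex \<Rightarrow> complex" and D :: "complex \<Rightarrow> real"
  assumes v: "v \<in> {1, \<i>}" and f: "continuous_on UNIV f" and g: "g \<in> borel_measurable borel"
    and D: "\<And>R. set_integrable lborel (cball 0 R) D"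
    and bound: "AE z in lborel. \<forall>h. 0 < h \<longrightarrow> h \<le> 1 \<longrightarrow> cmod (f z - f (z - of_real h * v)) \<le> h * D z"
    and lim: "AE z in lborel. ((\<lambda>h. (f z - f (z - of_real h * v)) / of_real h) \<longlongrightarrow> g z) (at_right 0)"
  shows "weak_partial f v g"
  unfolding weak_partial_def
proof (intro allI impI)
  fix \<phi> :: "complex \<Rightarrow> real"
  assume "test_fun \<phi>"
  from test_fun_bounds[OF this v] obtain R M where c: "continuous_on UNIV \<phi>"
    and cd: "continuous_on UNIV (dirderiv \<phi> v)" and RM: "0 \<le> R" "0 \<le> M"
    and d: "\<And>z. \<phi> differentiable (at z)" and z0: "\<And>z. R < cmod z \<Longrightarrow> \<phi> z = 0"
    and M: "\<And>z. \<bar>\<phi> z\<bar> \<le> M" "\<And>z. \<bar>dirderiv \<phi> v z\<bar> \<le> M" by metis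
  have v1: "cmod v = 1" using v by auto
  note [measurable] = borel_measurable_continuous_onI[OF f] g borel_measurable_continuous_onI[OF c]
    borel_measurable_continuous_onI[OF cd]
  define h where "h n = inverse (real (Suc n))" for n
  have h: "0 < h n" "h n \<le> 1" for n by (auto simp: h_def inverse_le_1_iff)
  have hlim: "filterlim h (at_right 0) sequentially"
    unfolding filterlim_at using LIMSEQ_inverse_real_of_nat by (auto simp: h_def[abs_def])
  have vd: "((\<lambda>t. \<phi> (z + of_real t * v)) has_vector_derivative dirderiv \<phi> v (z + of_real t * v)) (at t)"
    for z t by (rule dirderiv_has_vector_derivative[OF d])
  \<comment> \<open>The majorant lives on radius \<open>R + 1\<close>: a shift by
    \<open>of_real (h n) * v\<close> has length at most 1, so outside that ball both values of
    \<phi> vanish.\<close>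
  have L1: "(\<lambda>n. LINT z|lborel. of_real ((\<phi> (z + of_real (h n) * v) - \<phi> z) / h n) * f z)
    \<longlonglongrightarrow> (LINT z|lborel. of_real (dirderiv \<phi> v z) * f z)"
  proof (rule integral_dominated_convergence[where w="\<lambda>z. indicator (cball 0 (R + 1)) z *\<^sub>R (M * cmod (f z))"])
    have "continuous_on (cball 0 (R+1)) (\<lambda>z. M * cmod (f z))"
      by (intro continuous_intros continuous_on_subset[OF f]) auto
    then show "integrable lborel (\<lambda>z. indicator (cball 0 (R + 1)) z *\<^sub>R (M * cmod (f z)))"
      using borel_integrable_compact[OF compact_cball] by blast
    show "AE z in lborel. (\<lambda>n. of_real ((\<phi> (z + of_real (h n) * v) - \<phi> z) / h n) * f z)
          \<longlonglongrightarrow> of_real (dirderiv \<phi> v z) * f z"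
    proof (rule AE_I2)
      fix z :: complex
      have "((\<lambda>t. (\<phi> (z + of_real t * v) - \<phi> z) / t) \<longlongrightarrow> dirderiv \<phi> v z) (at 0)"
        using vd[of z 0] by (simp add: has_real_derivative_iff_has_vector_derivative[symmetric] has_field_derivative_iff)
      then have "((\<lambda>t. (\<phi> (z + of_real t * v) - \<phi> z) / t) \<longlongrightarrow> dirderiv \<phi> v z) (at_right 0)"
        using filterlim_mono at_le by blast
      from filterlim_compose[OF this hlim]
      show "(\<lambda>n. of_real ((\<phi> (z + of_real (h n) * v) - \<phi> z) / h n) * f z)
          \<longlonglongrightarrow> of_real (dirderiv \<phi> v z) * f z" by (intro tendsto_intros)
    qed
    fix n
    show "AE z in lborel. norm (of_real ((\<phi> (z + of_real (h n) * v) - \<phi> z) / h n) * f z)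
       \<le> indicator (cball 0 (R + 1)) z *\<^sub>R (M * cmod (f z))"
    proof (rule AE_I2)
      fix z :: complex
      have "norm (\<phi> (z + of_real (h n) * v) - \<phi> (z + of_real 0 * v)) \<le> M * h n - M * 0"
        by (rule differentiable_bound_general[where f'="\<lambda>t. dirderiv \<phi> v (z + of_real t * v)" and \<phi>'="\<lambda>_. M"])
          (use h[of n] vd M(2) in \<open>auto intro!: derivative_eq_intros continuous_intros continuous_on_compose2[OF c]\<close>)
      then have 1: "\<bar>(\<phi> (z + of_real (h n) * v) - \<phi> z) / h n\<bar> \<le> M"
        using h[of n] by (simp add: field_simps)
      show "norm (of_real ((\<phi> (z + of_real (h n) * v) - \<phi> z) / h n) * f z)
         \<le> indicator (cball 0 (R + 1)) z *\<^sub>R (M * cmod (f z))"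
      proof (cases "cmod z \<le> R + 1")
        case True
        then show ?thesis using 1 mult_right_mono[OF 1 norm_ge_zero[of "f z"]]
          by (simp add: norm_mult del: of_real_divide of_real_diff)
      next
        case False
        then have "\<phi> z = 0" by (intro z0) simp
        have "cmod (of_real (h n) * v) \<le> 1" using h[of n] v1 by (simp add: norm_mult)
        then have "cmod (z + of_real (h n) * v) > R"
          using False norm_triangle_ineq4[of "z + of_real (h n) * v" "of_real (h n) * v"] by simp
        then show ?thesis using \<open>\<phi> z = 0\<close> z0 RM by simp
      qed
    qed
  qed measurable
  \<comment> \<open>The translation turns the forward quotient of \<phi> into a backward quotient of
    \<open>f\<close>; this is why the hypotheses speak of
    \<open>f z - f (z - of_real h * v)\<close>.\<close>
  have eq: "(LINT z|lborel. of_real ((\<phi> (z + of_real (h n) * v) - \<phi> z) / h n) * f z)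
      = - (LINT z|lborel. of_real (\<phi> z) * ((f z - f (z - of_real (h n) * v)) / of_real (h n)))" for n
  proof -
    let ?c = "of_real (h n) * v"
    have e: "(a - b) / c = - ((b - a) / c)" for a b c :: complex by (simp add: diff_divide_distrib)
    have int: "integrable lborel (\<lambda>z. of_real (\<phi> z) * F z)" if F: "continuous_on UNIV F" for F :: "complex \<Rightarrow> complex"
    proof -
      have "continuous_on (cball 0 R) (\<lambda>z. of_real (\<phi> z) * F z)"
        by (intro continuous_intros continuous_on_subset[OF F] continuous_on_subset[OF c]) auto
      from borel_integrable_compact[OF compact_cball this]
      have "integrable lborel (\<lambda>z. indicator (cball 0 R) z *\<^sub>R (of_real (\<phi> z) * F z))" .
      moreover have "(\<lambda>z. indicator (cball 0 R) z *\<^sub>R (of_real (\<phi> z) * F z)) = (\<lambda>z. of_real (\<phi> z) * F z)"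
        using z0 by (auto simp: fun_eq_iff indicator_def)
      ultimately show ?thesis by simp
    qed
    have cs: "continuous_on UNIV (\<lambda>z. f (z - ?c))"
      by (intro continuous_on_compose2[OF f] continuous_intros) auto
    have sh: "(LINT z|lborel. of_real (\<phi> (z + ?c)) * f z) = (LINT z|lborel. of_real (\<phi> z) * f (z - ?c))"
      using lborel_integral_shift[of "\<lambda>z. of_real (\<phi> z) * f (z - ?c)" ?c] by (simp add: add.commute)
    have ish: "integrable lborel (\<lambda>z. of_real (\<phi> (z + ?c)) * f z)"
    proof -
      have "integrable (distr lborel borel ((+) ?c)) (\<lambda>z. of_real (\<phi> z) * f (z - ?c))"
        using int[OF cs] by (simp add: lborel_distr_plus)
      then have "integrable lborel (\<lambda>z. of_real (\<phi> (?c + z)) * f (?c + z - ?c))"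
        by (subst (asm) integrable_distr_eq) auto
      then show ?thesis by (simp add: add.commute)
    qed
    have "(LINT z|lborel. of_real ((\<phi> (z + ?c) - \<phi> z) / h n) * f z)
       = (LINT z|lborel. (of_real (\<phi> (z + ?c)) * f z - of_real (\<phi> z) * f z) / of_real (h n))"
      by (intro Bochner_Integration.integral_cong) (auto simp: field_simps)
    also have "\<dots> = ((LINT z|lborel. of_real (\<phi> (z + ?c)) * f z) - (LINT z|lborel. of_real (\<phi> z) * f z)) / of_real (h n)"
      using ish int[OF f] by simp
    also have "\<dots> = - (((LINT z|lborel. of_real (\<phi> z) * f z) - (LINT z|lborel. of_real (\<phi> z) * f (z - ?c))) / of_real (h n))"
      unfolding sh by (rule e)
    also have "\<dots> = - (LINT z|lborel. (of_real (\<phi> z) * f z - of_real (\<phi> z) * f (z - ?c)) / of_real (h n))"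
      using int[OF cs] int[OF f] by simp
    also have "\<dots> = - (LINT z|lborel. of_real (\<phi> z) * ((f z - f (z - ?c)) / of_real (h n)))"
      by (intro arg_cong[where f=uminus] Bochner_Integration.integral_cong) (auto simp: field_simps)
    finally show ?thesis .
  qed
  have L2: "(\<lambda>n. LINT z|lborel. of_real (\<phi> z) * ((f z - f (z - of_real (h n) * v)) / of_real (h n)))
      \<longlonglongrightarrow> (LINT z|lborel. of_real (\<phi> z) * g z)"
  proof (rule integral_dominated_convergence[where w="\<lambda>z. M * (indicator (cball 0 R) z *\<^sub>R D z)"])
    show "integrable lborel (\<lambda>z. M * (indicator (cball 0 R) z *\<^sub>R D z))"
      using D[of R] unfolding set_integrable_def by simp
    show "AE z in lborel. (\<lambda>n. of_real (\<phi> z) * ((f z - f (z - of_real (h n) * v)) / of_real (h n)))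
            \<longlonglongrightarrow> of_real (\<phi> z) * g z"
      using lim by eventually_elim (intro tendsto_intros filterlim_compose[OF _ hlim])
    fix n
    show "AE z in lborel. norm (of_real (\<phi> z) * ((f z - f (z - of_real (h n) * v)) / of_real (h n)))
       \<le> M * (indicator (cball 0 R) z *\<^sub>R D z)"
      using bound
    proof eventually_elim
      case (elim z)
      then have "cmod (f z - f (z - of_real (h n) * v)) \<le> h n * D z" using h[of n] by blast
      then have 1: "cmod ((f z - f (z - of_real (h n) * v)) / of_real (h n)) \<le> D z"
        using h[of n] by (simp add: norm_divide field_simps)
      show ?case
      proof (cases "cmod z \<le> R")
        case True
        then show ?thesis using mult_mono[OF M(1)[of z] 1 RM(2) norm_ge_zero] True
          by (simp add: norm_mult norm_divide)
      next
        case False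
        then show ?thesis using z0 by simp
      qed
    qed
  qed measurable
  have "(LINT z|lborel. of_real (dirderiv \<phi> v z) * f z) = - (LINT z|lborel. of_real (\<phi> z) * g z)"
    using LIMSEQ_unique[OF L1[unfolded eq] tendsto_minus[OF L2]] .
  then show "(LINT z|lebesgue. of_real (dirderiv \<phi> v z) * f z) = - (LINT z|lebesgue. of_real (\<phi> z) * g z)"
    by (simp add: integral_completion)
qed

section \<open>Integrability of powers of the distance to the axis\<close>

text \<open>Layers replace an iterated integral: the part of the ball with 4^(-n-1) < |Im z| \<le>
  4^(-n) lies in a box of area 4 r 4^(-n), where the weight is at most 2 * 2^n. The masses are
  dominated by the geometric series of 8 r 2^(-n). The rest, |Im z| \<ge> 1 or Im z = 0, is covered
  by the indicator of the ball.\<close>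

lemma set_integrable_Im_powr:
  "set_integrable lborel (cball 0 R) (\<lambda>z. \<bar>Im z\<bar> powr (-1/2))"
proof -
  have [measurable]: "Im \<in> borel_measurable borel" "cball (0::complex) R \<in> sets borel"
    by (auto intro!: borel_measurable_continuous_onI continuous_intros)
  define r where "r = \<bar>R\<bar>"
  define S where "S n = cbox (Complex (-r) (- ((1/4)^n))) (Complex r ((1/4)^n))" for n :: nat
  have em: "emeasure lborel (S n) = ennreal (4 * r * (1/4)^n)" for n
    unfolding S_def r_def emeasure_lborel_cbox_eq
    by (auto simp: Basis_complex_def ennreal_mult[symmetric] intro!: arg_cong[where f=ennreal])
  have pt: "ennreal (norm (indicator (cball 0 R) z *\<^sub>R (\<bar>Im z\<bar> powr (-1/2))))
     \<le> indicator (cball 0 R) z + (\<Sum>n. ennreal (2 * 2^n) * indicator (S n) z)" for z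
  proof (cases "z \<in> cball 0 R \<and> Im z \<noteq> 0 \<and> \<bar>Im z\<bar> < 1")
    case False
    have "\<bar>Im z\<bar> powr (-1/2) \<le> 1" if "z \<in> cball 0 R"
      using False that powr_mono2'[of "-1/2" 1 "\<bar>Im z\<bar>"] by (cases "Im z = 0") auto
    then have "ennreal (norm (indicator (cball 0 R) z *\<^sub>R (\<bar>Im z\<bar> powr (-1/2)))) \<le> indicator (cball 0 R) z"
      by (auto simp: indicator_def ennreal_le_1)
    then show ?thesis by (meson add_increasing2 order_trans zero_le)
  next
    case True
    define P where "P n \<longleftrightarrow> \<bar>Im z\<bar> \<le> (1/4)^n" for n :: nat
    have P0: "P 0" using True by (simp add: P_def)
    obtain N where "(1/4::real)^N < \<bar>Im z\<bar>" using real_arch_pow_inv[of "\<bar>Im z\<bar>" "1/4"] True by auto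
    then have "\<not> P N" by (simp add: P_def)
    \<comment> \<open>Induction up to \<open>N\<close> would prove \<open>P N\<close>, so it breaks
      at some \<open>n\<close>; this is the layer containing \<open>z\<close>.\<close>
    with P0 obtain n where n: "P n" "\<not> P (Suc n)"
      using nat_induct[of P N] by blast
    have "\<bar>Im z\<bar> powr (-1/2) \<le> ((1/4)^(Suc n)) powr (-1/2)"
      using n(2) by (intro powr_mono2') (auto simp: P_def)
    also have "\<dots> = 2 * 2^n"
    proof -
      have "((1/4::real)^(Suc n)) = (1/4) powr real (Suc n)" by (rule powr_realpow[symmetric]) simp
      then have "((1/4::real)^(Suc n)) powr (-1/2) = (1/4) powr (- 1/2 * real (Suc n))"
        by (simp add: powr_powr)
      also have "\<dots> = ((1/4) powr (-1/2)) powr real (Suc n)" by (simp add: powr_powr)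
      also have "(1/4::real) powr (-1/2) = 2"
        using real_sqrt_four by (simp add: powr_minus powr_half_sqrt real_sqrt_divide)
      finally show ?thesis using powr_realpow[of 2 "Suc n"] by simp
    qed
    finally have "ennreal (\<bar>Im z\<bar> powr (-1/2)) \<le> ennreal (2 * 2^n)" by (rule ennreal_leI)
    moreover have "z \<in> S n"
    proof -
      have "\<bar>Re z\<bar> \<le> r" using True abs_Re_le_cmod[of z] by (auto simp: r_def)
      then show ?thesis using n(1) unfolding S_def P_def in_cbox_complex_iff by auto
    qed
    ultimately have "ennreal (\<bar>Im z\<bar> powr (-1/2)) \<le> ennreal (2 * 2^n) * indicator (S n) z" by simp
    also have "\<dots> \<le> (\<Sum>n. ennreal (2 * 2^n) * indicator (S n) z)"
    proof -
      have "f n \<le> suminf f" for f :: "nat \<Rightarrow> ennreal"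
        using sum_le_suminf[of f "{n}"] by simp
      then show ?thesis .
    qed
    finally show ?thesis using True by (simp add: add_increasing)
  qed
  have "(\<integral>\<^sup>+z. ennreal (norm (indicator (cball 0 R) z *\<^sub>R (\<bar>Im z\<bar> powr (-1/2)))) \<partial>lborel)
     \<le> (\<integral>\<^sup>+z. indicator (cball 0 R) z + (\<Sum>n. ennreal (2 * 2^n) * indicator (S n) z) \<partial>lborel)"
    by (rule nn_integral_mono) (rule pt)
  also have "\<dots> = emeasure lborel (cball (0::complex) R) + (\<Sum>n. ennreal (2 * 2^n) * emeasure lborel (S n))"
    by (subst nn_integral_add) (auto simp: nn_integral_suminf nn_integral_cmult S_def)
  also have "(\<Sum>n. ennreal (2 * 2^n) * emeasure lborel (S n)) = (\<Sum>n. ennreal (8 * r * (1/2)^n))"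
  proof (rule suminf_cong)
    fix n :: nat
    have "(2::real)^n * (1/4)^n = (1/2)^n" by (simp flip: power_mult_distrib)
    then have "2 * 2^n * (4 * r * (1/4)^n) = 8 * r * (1/2)^n" by (simp add: mult.assoc mult.left_commute)
    then show "ennreal (2 * 2^n) * emeasure lborel (S n) = ennreal (8 * r * (1/2)^n)"
      unfolding em by (subst ennreal_mult[symmetric]) (auto simp: r_def)
  qed
  also have "\<dots> < \<infinity>"
  proof -
    have "summable (\<lambda>n. 8 * r * (1/2)^n)" by (intro summable_mult summable_geometric) auto
    then show ?thesis by (subst suminf_ennreal2) (auto simp: r_def)
  qed
  finally have fin: "(\<integral>\<^sup>+z. ennreal (norm (indicator (cball 0 R) z *\<^sub>R (\<bar>Im z\<bar> powr (-1/2)))) \<partial>lborel) < \<infinity>"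
    using emeasure_lborel_cball_finite[of "0::complex" R] by (simp add: less_top)
  show ?thesis unfolding set_integrable_def
    by (rule integrableI_bounded[OF _ fin]) measurable
qed

text \<open>Squaring turns the exponent -1/4 into -1/2, still integrable across the axis; the
  constant term is absorbed by (p + 1)^2 \<le> 2 (p^2 + 1).\<close>

lemma L2loc_of_bound:
  assumes [measurable]: "g \<in> borel_measurable borel"
    and b: "\<And>z. cmod (g z) \<le> K * (\<bar>Im z\<bar> powr (-1/4) + 1)"
  shows "L2loc g"
  unfolding L2loc_def
proof (intro conjI allI impI)
  show "g \<in> borel_measurable lebesgue" by (rule measurable_completion) simp
  fix S :: "complex set" assume S: "compact S"
  then obtain R where R: "S \<subseteq> cball 0 R" using bounded_subset_ballD[OF compact_imp_bounded, of S 0] ball_subset_cball by blast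
  have [measurable]: "S \<in> sets borel" using S by (simp add: compact_imp_closed)
  have 1: "integrable lborel (\<lambda>z. 2 * K\<^sup>2 * (indicator (cball 0 R) z *\<^sub>R (\<bar>Im z\<bar> powr (-1/2)) + indicator (cball 0 R) z))"
    using set_integrable_Im_powr[of R] emeasure_lborel_cball_finite[of "0::complex" R]
    unfolding set_integrable_def by (intro integrable_mult_right Bochner_Integration.integrable_add) auto
  have 2: "(cmod (g z))\<^sup>2 \<le> 2 * K\<^sup>2 * (\<bar>Im z\<bar> powr (-1/2) + 1)" for z
  proof -
    define p where "p = \<bar>Im z\<bar> powr (-1/4)"
    have pp: "\<bar>Im z\<bar> powr (-1/2) = p^2"
      by (simp add: p_def powr_powr power2_eq_square flip: powr_add)
    have "(cmod (g z))\<^sup>2 \<le> (K * (p + 1))\<^sup>2" using b[of z] by (intro power_mono) (auto simp: p_def)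
    also have "\<dots> \<le> K\<^sup>2 * (2 * (p^2 + 1))" unfolding power_mult_distrib
      by (intro mult_left_mono) (use sum_squares_bound[of p 1] in \<open>auto simp: power2_sum\<close>)
    finally show ?thesis unfolding pp by (simp add: algebra_simps)
  qed
  have "integrable lborel (\<lambda>z. indicator S z *\<^sub>R (cmod (g z))\<^sup>2)"
  proof (rule Bochner_Integration.integrable_bound[OF 1])
    show "AE z in lborel. norm (indicator S z *\<^sub>R (cmod (g z))\<^sup>2) \<le>
      norm (2 * K\<^sup>2 * (indicator (cball 0 R) z *\<^sub>R (\<bar>Im z\<bar> powr (-1/2)) + indicator (cball 0 R) z))"
      using 2 R by (intro AE_I2) (auto simp: indicator_def abs_mult)
  qed measurable
  then show "set_integrable lebesgue S (\<lambda>z. (cmod (g z))\<^sup>2)"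
    unfolding set_integrable_def by (subst integrable_completion) auto
qed

lemma set_integrable_Im_powr_quarter:
  "set_integrable lborel (cball 0 R) (\<lambda>z. K * (\<bar>Im z\<bar> powr (-1/4) + 1))"
proof -
  have [measurable]: "Im \<in> borel_measurable borel" "cball (0::complex) R \<in> sets borel"
    by (auto intro!: borel_measurable_continuous_onI continuous_intros)
  have 1: "integrable lborel (\<lambda>z. \<bar>K\<bar> * (indicator (cball 0 R) z *\<^sub>R (\<bar>Im z\<bar> powr (-1/2)) + 2 * indicator (cball 0 R) z))"
    using set_integrable_Im_powr[of R] emeasure_lborel_cball_finite[of "0::complex" R]
    unfolding set_integrable_def by (intro integrable_mult_right Bochner_Integration.integrable_add) auto
  have 2: "\<bar>y\<bar> powr (-1/4) + 1 \<le> \<bar>y\<bar> powr (-1/2) + 2" for y :: real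
  proof -
    define p where "p = \<bar>y\<bar> powr (-1/4)"
    have pp: "\<bar>y\<bar> powr (-1/2) = p^2"
      by (simp add: p_def powr_powr power2_eq_square flip: powr_add)
    show ?thesis unfolding pp p_def[symmetric] using sum_squares_bound[of p 1] powr_ge_zero[of "\<bar>y\<bar>" "-1/4"] unfolding p_def[symmetric] by simp
  qed
  show ?thesis unfolding set_integrable_def
  proof (rule Bochner_Integration.integrable_bound[OF 1])
    show "AE z in lborel. norm (indicator (cball 0 R) z *\<^sub>R (K * (\<bar>Im z\<bar> powr (-1/4) + 1))) \<le>
      norm (\<bar>K\<bar> * (indicator (cball 0 R) z *\<^sub>R (\<bar>Im z\<bar> powr (-1/2)) + 2 * indicator (cball 0 R) z))"
      using 2 by (intro AE_I2) (auto simp: indicator_def abs_mult intro!: mult_left_mono)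
  qed measurable
qed

section \<open>Antiderivatives and mean value inequalities with a singular weight, in one
  variable\<close>

definition antideriv :: "(real \<Rightarrow> complex) \<Rightarrow> real \<Rightarrow> complex" where
  "antideriv f = (SOME F. \<forall>x. (F has_vector_derivative f x) (at x))"

lemma antideriv:
  assumes "continuous_on UNIV f"
  shows "(antideriv f has_vector_derivative f x) (at x)"
proof -
  have "\<exists>F. \<forall>x :: real. (-\<infinity> :: ereal) < x \<longrightarrow> x < (\<infinity> :: ereal) \<longrightarrow> (F has_vector_derivative f x) (at x)"
    using assms by (intro einterval_antiderivative) (auto simp: continuous_on_eq_continuous_at)
  then have "\<exists>F. \<forall>x. (F has_vector_derivative f x) (at x)" by simp
  then have "\<forall>x. (antideriv f has_vector_derivative f x) (at x)"
    unfolding antideriv_def by (rule someI_ex)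
  then show ?thesis by blast
qed

lemma continuous_on_antideriv: "continuous_on UNIV f \<Longrightarrow> continuous_on S (antideriv f)"
  using antideriv continuous_on_subset
  by (metis continuous_at_imp_continuous_on has_vector_derivative_continuous)

lemma has_vector_derivative_shift:
  assumes "(F has_vector_derivative D) (at (x + s))"
  shows "((\<lambda>s. F (x + s)) has_vector_derivative D) (at (s::real))"
proof -
  have "((+) x has_vector_derivative 1) (at s)" by (auto intro!: derivative_eq_intros)
  from vector_diff_chain_at[OF this, of F D] assms show ?thesis by (simp add: o_def)
qed

lemma has_vector_derivative_reflect:
  assumes "(F has_vector_derivative D) (at (x - s))"
  shows "((\<lambda>s. F (x - s)) has_vector_derivative - D) (at (s::real))"
proof -
  have "((-) x has_vector_derivative -1) (at s)" by (auto intro!: derivative_eq_intros)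
  from vector_diff_chain_at[OF this, of F D] assms show ?thesis by (simp add: o_def)
qed

lemma has_vector_derivative_shift':
  assumes "(F has_vector_derivative D) (at (s + y))"
  shows "((\<lambda>s. F (s + y)) has_vector_derivative D) (at (s::real))"
  using has_vector_derivative_shift[of F D y s] assms by (simp add: add.commute)

lemma has_vector_derivative_shift_diff:
  assumes "(F has_vector_derivative D) (at (s - y))"
  shows "((\<lambda>s. F (s - y)) has_vector_derivative D) (at (s::real))"
  using has_vector_derivative_shift'[of F D s "-y"] assms by simp

lemma has_vector_derivative_left_quotient:
  fixes F :: "real \<Rightarrow> complex"
  assumes "(F has_vector_derivative D) (at x)"
  shows "((\<lambda>h. (F x - F (x - h)) / of_real h) \<longlongrightarrow> D) (at_right 0)"
proof -
  have "((\<lambda>h. F (x - h)) has_vector_derivative - D) (at 0)"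
    using has_vector_derivative_reflect[of F D x 0] assms by simp
  then have "((\<lambda>h. norm (F (x - h) - F x - h *\<^sub>R (- D)) / norm h) \<longlongrightarrow> 0) (at 0)"
    by (simp add: has_vector_derivative_def has_derivative_at)
  then have "((\<lambda>h. norm (F (x - h) - F x - h *\<^sub>R (- D)) / norm h) \<longlongrightarrow> 0) (at_right 0)"
    using filterlim_mono at_le by blast
  moreover have "\<forall>\<^sub>F h in at_right 0. norm (F (x - h) - F x - h *\<^sub>R (- D)) / norm h
      = norm ((F x - F (x - h)) / of_real h - D)"
  proof (rule eventually_at_right_less[THEN eventually_mono])
    fix h :: real assume "0 < h"
    then have "(F x - F (x - h)) / of_real h - D = - ((F (x - h) - F x - h *\<^sub>R (- D)) / of_real h)"
      by (simp add: scaleR_conv_of_real diff_divide_distrib add_divide_distrib)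
    then show "norm (F (x - h) - F x - h *\<^sub>R (- D)) / norm h = norm ((F x - F (x - h)) / of_real h - D)"
      by (simp add: norm_divide)
  qed
  ultimately have "((\<lambda>h. norm ((F x - F (x - h)) / of_real h - D)) \<longlongrightarrow> 0) (at_right 0)"
    by (rule Lim_transform_eventually)
  then show ?thesis by (rule LIM_zero_cancel[OF tendsto_norm_zero_cancel])
qed

lemma powr_three_quarters: "0 < t \<Longrightarrow> t powr (3/4) = t * t powr (-1/4)" for t :: real
  using powr_mult_base[of t "-1/4"] by simp

lemma singular_derivative_bound:
  fixes P :: "real \<Rightarrow> complex"
  assumes c: "continuous_on UNIV P"
    and d: "\<And>s. s \<noteq> 0 \<Longrightarrow> (P has_vector_derivative P' s) (at s)"
    and b: "\<And>s. s \<noteq> 0 \<Longrightarrow> cmod (P' s) \<le> K * (\<bar>s\<bar> powr (-1/4) + 1)"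
    and a: "0 \<le> a" "a \<le> b"
  shows "cmod (P b - P a) \<le> K * (4/3 * (b powr (3/4) - a powr (3/4)) + (b - a))"
proof (cases "a = b")
  case False
  have "norm (P b - P a) \<le> K * (4/3 * b powr (3/4) + b) - K * (4/3 * a powr (3/4) + a)"
  proof (rule differentiable_bound_general[where f'=P' and \<phi>'="\<lambda>s. K * (s powr (-1/4) + 1)"])
    show "continuous_on {a..b} (\<lambda>s. K * (4/3 * s powr (3/4) + s))"
      using a by (intro continuous_intros continuous_on_powr') auto
    show "((\<lambda>s. K * (4/3 * s powr (3/4) + s)) has_vector_derivative K * (s powr (-1/4) + 1)) (at s)"
      if "a < s" "s < b" for s
      unfolding has_real_derivative_iff_has_vector_derivative[symmetric]
      using that a by (auto intro!: derivative_eq_intros)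
    show "a < b" using a False by simp
    show "continuous_on {a..b} P" by (rule continuous_on_subset[OF c]) simp
    show "(P has_vector_derivative P' s) (at s)" if "a < s" "s < b" for s
      using d[of s] that a by simp
    show "norm (P' s) \<le> K * (s powr (-1/4) + 1)" if "a < s" "s < b" for s
      using b[of s] that a by simp
  qed
  then show ?thesis by (simp add: algebra_simps)
qed simp

text \<open>The weight \<open>\<bar>s\<bar> powr (-1/4)\<close> is of Muckenhoupt class \<open>A\<^sub>1\<close>: its average over an
  interval is controlled by its value at either endpoint.\<close>
lemma singular_derivative_quotient:
  fixes P :: "real \<Rightarrow> complex"
  assumes c: "continuous_on UNIV P"
    and d: "\<And>s. s \<noteq> 0 \<Longrightarrow> (P has_vector_derivative P' s) (at s)"
    and b: "\<And>s. s \<noteq> 0 \<Longrightarrow> cmod (P' s) \<le> K * (\<bar>s\<bar> powr (-1/4) + 1)"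
    and h: "0 < h" and y: "y \<noteq> 0" and K: "0 \<le> K"
  shows "cmod (P y - P (y - h)) \<le> h * (3 * K * (\<bar>y\<bar> powr (-1/4) + 1))"
proof -
  note right = singular_derivative_bound[OF c d b]
  have left: "cmod (P b - P a) \<le> K * (4/3 * ((-a) powr (3/4) - (-b) powr (3/4)) + (b - a))"
    if "a \<le> b" "b \<le> 0" for a b
  proof -
    have "cmod (P (- (- a)) - P (- (- b))) \<le> K * (4/3 * ((-a) powr (3/4) - (-b) powr (3/4)) + (- a - - b))"
    proof (rule singular_derivative_bound[where P="\<lambda>s. P (- s)" and P'="\<lambda>s. - P' (- s)"])
      show "continuous_on UNIV (\<lambda>s. P (- s))"
        by (intro continuous_on_compose2[OF c] continuous_intros) auto
      show "((\<lambda>s. P (- s)) has_vector_derivative - P' (- s)) (at s)" if "s \<noteq> 0" for s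
        using has_vector_derivative_reflect[of P "P' (-s)" 0 s] d[of "-s"] that by simp
      show "cmod (- P' (- s)) \<le> K * (\<bar>s\<bar> powr (-1/4) + 1)" if "s \<noteq> 0" for s
        using b[of "-s"] that by simp
    qed (use that in auto)
    then show ?thesis by (simp add: norm_minus_commute)
  qed
  define w where "w = \<bar>y\<bar> powr (-1/4)"
  have w: "0 \<le> w" by (simp add: w_def)
  have ww: "t powr (3/4) \<le> t * w" if "\<bar>y\<bar> \<le> t" for t
  proof -
    have "t powr (-1/4) \<le> w" unfolding w_def using that y by (intro powr_mono2') auto
    then show ?thesis using that y powr_three_quarters[of t] by (simp add: mult_left_mono)
  qed
  have wy: "\<bar>y\<bar> powr (3/4) = \<bar>y\<bar> * w" using powr_three_quarters[of "\<bar>y\<bar>"] y by (simp add: w_def)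
  \<comment> \<open>It suffices to bound the variation \<open>q\<close> of |s|^(3/4) by 2 h w. The
    factor 2 is for intervals that contain 0, and 4/3 * 2 \<le> 3 explains the 3 in the
    conclusion.\<close>
  have fin: ?thesis if "cmod (P y - P (y - h)) \<le> K * (4/3 * q + h)" "q \<le> 2 * h * w" for q
  proof -
    have "4/3 * q + h \<le> h * (3 * (w + 1))"
    proof -
      have "0 \<le> h * w" using h w by simp
      moreover have "h * (3 * (w + 1)) = 3 * (h * w) + 3 * h" by (simp add: algebra_simps)
      ultimately show ?thesis using that(2) h by argo
    qed
    then have "K * (4/3 * q + h) \<le> K * (h * (3 * (w + 1)))" using K by (rule mult_left_mono)
    then show ?thesis using that(1) by (simp add: w_def algebra_simps)
  qed
  consider "0 < y" "h \<le> y" | "0 < y" "y < h" | "y < 0" using y by linarith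
  then show ?thesis
  proof cases
    case 1
    have lw: "(y - h) * w \<le> (y - h) powr (3/4)"
    proof (cases "y = h")
      case False
      have "w \<le> (y - h) powr (-1/4)" unfolding w_def using 1 False h by (intro powr_mono2') auto
      then show ?thesis using 1 False powr_three_quarters[of "y - h"] by (simp add: mult_left_mono)
    qed simp
    have "cmod (P y - P (y - h)) \<le> K * (4/3 * (y powr (3/4) - (y - h) powr (3/4)) + h)"
      using right[of "y - h" y] 1 h by simp
    moreover have "y powr (3/4) - (y - h) powr (3/4) \<le> 2 * h * w"
    proof -
      have "y powr (3/4) - (y - h) powr (3/4) \<le> y * w - (y - h) * w" using lw wy 1 by simp
      also have "\<dots> = h * w" by (simp add: algebra_simps)
      also have "\<dots> \<le> 2 * h * w" using h w by simp
      finally show ?thesis .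
    qed
    ultimately show ?thesis by (rule fin)
  next
    \<comment> \<open>The interval crosses 0 and is split there. Both pieces are no longer than
      \<open>h\<close>, and h > |y| gives h^(3/4) \<le> h w, so each contributes at most h
      w.\<close>
    case 2
    have "(h - y) powr (3/4) \<le> h powr (3/4)" using 2 by (intro powr_mono2) auto
    also have "\<dots> \<le> h * w" using 2 by (intro ww) auto
    finally have 3: "(h - y) powr (3/4) \<le> h * w" .
    have 4: "y powr (3/4) \<le> h * w" using wy 2 w by (simp add: mult_right_mono)
    have "cmod (P y - P (y - h)) \<le> cmod (P y - P 0) + cmod (P 0 - P (y - h))"
      using norm_triangle_ineq[of "P y - P 0" "P 0 - P (y - h)"] by simp
    also have "\<dots> \<le> K * (4/3 * y powr (3/4) + y) + K * (4/3 * (h - y) powr (3/4) + (h - y))"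
      using right[of 0 y] left[of "y - h" 0] 2 by (intro add_mono) simp_all
    also have "\<dots> = K * (4/3 * (y powr (3/4) + (h - y) powr (3/4)) + h)" by (simp add: algebra_simps)
    finally have 5: "cmod (P y - P (y - h)) \<le> K * (4/3 * (y powr (3/4) + (h - y) powr (3/4)) + h)" .
    show ?thesis using 3 4 by (intro fin[OF 5]) simp
  next
    case 3
    have "cmod (P y - P (y - h)) \<le> K * (4/3 * ((h - y) powr (3/4) - (- y) powr (3/4)) + h)"
      using left[of "y - h" y] 3 h by simp
    moreover have "(h - y) powr (3/4) - (- y) powr (3/4) \<le> 2 * h * w"
    proof -
      have "(h - y) powr (3/4) - (- y) powr (3/4) \<le> (h - y) * w - (- y) * w"
        using ww[of "h - y"] wy 3 h by simp
      also have "\<dots> = h * w" by (simp add: algebra_simps)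
      also have "\<dots> \<le> 2 * h * w" using h w by simp
      finally show ?thesis .
    qed
    ultimately show ?thesis by (rule fin)
  qed
qed

lemma AE_Im_nonzero: "AE z in lborel. Im z \<noteq> 0"
proof (rule AE_I')
  have "negligible {z::complex. z \<bullet> \<i> = 0}"
    by (rule negligible_standard_hyperplane) (simp add: Basis_complex_def)
  moreover have "{z::complex. z \<bullet> \<i> = 0} = {z. Im z = 0}" by (auto simp: inner_complex_def)
  moreover have "closed {z. Im z = 0}" by (intro closed_Collect_eq continuous_intros)
  ultimately show "{z. Im z = 0} \<in> null_sets lborel"
    using null_sets_completion_iff[of "{z. Im z = 0}" lborel] by (simp add: negligible_iff_null_sets)
qed auto

section \<open>Extension of curves with small second differences\<close>

text \<open>A Zygmund condition with the increment of \<open>Re v\<close> as the gauge. The constant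
  20 is large enough for the distortion bound and for the contraction factor 11/20 in
  \<open>osc_doubling\<close>; \<open>growth\<close> supplies the scale 1 at which the descent to
  small scales starts.\<close>

locale zygmund_curve =
  fixes v :: "real \<Rightarrow> complex" and C :: real
  assumes cont: "continuous_on UNIV v"
    and zyg: "0 < t \<Longrightarrow> 20 * cmod (v (x + t) - 2 * v x + v (x - t)) \<le> Re (v (x + t)) - Re (v (x - t))"
    and growth: "0 \<le> t \<Longrightarrow> t \<le> 1 \<Longrightarrow> cmod (v (x + t) - v x) \<le> C"
begin

section \<open>Monotonicity and Hoelder continuity from the second difference condition\<close>

lemma Re_mono: "x \<le> y \<Longrightarrow> Re (v x) \<le> Re (v y)"
proof (cases "x < y")
  case True
  \<comment> \<open>The right side of \<open>zyg\<close> dominates a norm, so it is nonnegative;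
    centring it at the midpoint of [x, y] compares the two end points.\<close>
  have "0 \<le> Re (v ((x+y)/2 + (y-x)/2)) - Re (v ((x+y)/2 - (y-x)/2))"
    using order_trans[OF _ zyg[of "(y-x)/2" "(x+y)/2"], of 0] True by simp
  moreover have "(x+y)/2 + (y-x)/2 = y" "(x+y)/2 - (y-x)/2 = x" by (simp_all add: field_simps)
  ultimately show ?thesis by simp
qed auto

lemma C_nonneg: "0 \<le> C"
  using growth[of 0 0] by simp

text \<open>The error in \<open>zyg\<close> is measured by the real increment over the doubled
  interval, so the norm alone does not satisfy a closed recursion. Adding the real increment closes
  it.\<close>

definition osc :: "real \<Rightarrow> real \<Rightarrow> real" where
  "osc x t = cmod (v (x + t) - v x) + (Re (v (x + t)) - Re (v x))"

text \<open>Write D for the increment of \<open>v\<close> over [x, x + 2t] and R for its real part.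
  The norm in \<open>osc x t\<close> contributes at most 10 |D| + R/2 to the left side and the real
  increment at most 21/2 R, in total 10 |D| + 11 R.\<close>

lemma osc_doubling: "0 < t \<Longrightarrow> 20 * osc x t \<le> 11 * osc x (2 * t)"
proof -
  assume "0 < t"
  from zyg[OF this, of "x + t"]
  have z: "20 * cmod (v (x + 2*t) - 2 * v (x + t) + v x) \<le> Re (v (x + 2*t)) - Re (v x)"
    by (simp add: algebra_simps)
  have "2 * (v (x + t) - v x) = (v (x + 2*t) - v x) - (v (x + 2*t) - 2 * v (x + t) + v x)" by simp
  then have "2 * cmod (v (x + t) - v x) \<le> cmod (v (x + 2*t) - v x) + cmod (v (x + 2*t) - 2 * v (x + t) + v x)"
    by (metis norm_triangle_ineq4 norm_mult norm_numeral)
  moreover have "20 * \<bar>Re (v (x + 2*t) - 2 * v (x + t) + v x)\<bar> \<le> Re (v (x + 2*t)) - Re (v x)"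
    using order_trans[OF mult_left_mono[OF abs_Re_le_cmod] z] by simp
  then have "40 * Re (v (x + t)) \<le> 19 * Re (v x) + 21 * Re (v (x + 2*t))"
    using abs_ge_minus_self[of "Re (v (x + 2*t) - 2 * v (x + t) + v x)"] by simp
  ultimately show ?thesis using z norm_ge_zero[of "v (x + 2*t) - v x"]
    unfolding osc_def by argo
qed

text \<open>Doubling is applied until the length lies in (1/2, 1], where \<open>growth\<close> takes
  over; \<open>n\<close> bounds the number of doublings.\<close>

lemma osc_small:
  assumes "0 < t" "t \<le> 1"
  shows "osc x t \<le> 4 * C * t powr (3/4)"
proof -
  have "\<exists>n. (1/2::real)^n < t" using real_arch_pow_inv[of t "1/2"] assms by auto
  then obtain n where "(1/2)^n < t" by blast
  then show ?thesis using assms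
  proof (induction n arbitrary: t)
    case (Suc n)
    show ?case
    proof (cases "t \<le> 1/2")
      case True
      \<comment> \<open>The choice of exponent: an exponent a must satisfy 2^a \<le> 20/11 here, and
        a > 1/2 for |y|^(a-1) to be locally square integrable. The value 3/4 meets both.\<close>
      have p: "(2::real) powr (3/4) \<le> 20/11"
      proof -
        have "((2::real) powr (3/4))^4 = 2 powr (3/4 * 4)" by (simp add: powr_powr flip: powr_realpow)
        then have "((2::real) powr (3/4))^4 \<le> (20/11)^4" by (simp add: power_divide)
        then show ?thesis by (rule power_le_imp_le_base[of _ 3, simplified]) simp
      qed
      have "osc x t \<le> 11/20 * osc x (2*t)" using osc_doubling[of t x] Suc.prems by simp
      also have "\<dots> \<le> 11/20 * (4 * C * (2*t) powr (3/4))"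
        using Suc.IH[of "2*t"] Suc.prems True by simp
      also have "\<dots> = 11/20 * (4 * C * t powr (3/4)) * 2 powr (3/4)"
        using Suc.prems by (simp add: powr_mult)
      also have "\<dots> \<le> 11/20 * (4 * C * t powr (3/4)) * (20/11)"
        using C_nonneg by (intro mult_left_mono p) auto
      finally show ?thesis by simp
    next
      case False
      have "osc x t \<le> 2 * C" using growth[of t x] Suc.prems complex_Re_le_cmod[of "v (x+t) - v x"]
        by (simp add: osc_def)
      also have "\<dots> = 4 * C * (1/2)" by simp
      also have "\<dots> \<le> 4 * C * t powr (3/4)"
      proof (rule mult_left_mono)
        have "t powr 1 \<le> t powr (3/4)" using Suc.prems by (intro powr_mono') auto
        then show "1/2 \<le> t powr (3/4)" using False Suc.prems by simp
      qed (use C_nonneg in auto)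
      finally show ?thesis .
    qed
  qed simp
qed

text \<open>Beyond length 1 the increment is chained through unit steps, whence the linear
  term.\<close>

lemma holder: "0 \<le> t \<Longrightarrow> cmod (v (x + t) - v x) \<le> 4 * C * (t powr (3/4) + t)"
proof -
  assume t: "0 \<le> t"
  consider "t = 0" | "0 < t" "t \<le> 1" | "1 < t" using t by linarith
  then show ?thesis
  proof cases
    case 2
    have "cmod (v (x + t) - v x) \<le> osc x t" using Re_mono[of x "x+t"] t by (simp add: osc_def)
    also have "\<dots> \<le> 4 * C * t powr (3/4)" using osc_small 2 by blast
    also have "\<dots> \<le> 4 * C * (t powr (3/4) + t)" using C_nonneg t by (intro mult_left_mono) auto
    finally show ?thesis .
  next
    case 3
    have st: "cmod (v (x + real n) - v x) \<le> real n * C" for n x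
    proof (induction n)
      case (Suc n)
      have "cmod (v (x + real (Suc n)) - v x) \<le> cmod (v ((x + real n) + 1) - v (x + real n)) + cmod (v (x + real n) - v x)"
        using norm_triangle_ineq[of "v ((x + real n) + 1) - v (x + real n)" "v (x + real n) - v x"]
        by (simp add: add.assoc add.commute[of 1])
      then show ?case using Suc growth[of 1 "x + real n"] by (simp add: algebra_simps)
    qed simp
    define n where "n = nat \<lfloor>t\<rfloor>"
    have n: "real n \<le> t" "t \<le> real n + 1" using 3 unfolding n_def by linarith+
    have "cmod (v (x + t) - v x) \<le> cmod (v ((x + real n) + (t - real n)) - v (x + real n)) + cmod (v (x + real n) - v x)"
      using norm_triangle_ineq[of "v (x+t) - v (x + real n)" "v (x + real n) - v x"] by simp
    also have "\<dots> \<le> C + real n * C" using growth[of "t - real n" "x + real n"] st[of x n] n by simp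
    also have "\<dots> \<le> 4 * C * t"
    proof -
      have "C * (1 + real n) \<le> C * (4 * t)" using n 3 C_nonneg by (intro mult_left_mono) auto
      then show ?thesis by (simp add: algebra_simps)
    qed
    also have "\<dots> \<le> 4 * C * (t powr (3/4) + t)" using C_nonneg t by (intro mult_left_mono) auto
    finally show ?thesis .
  qed simp
qed

section \<open>Differences of the curve and of its first two antiderivatives\<close>

abbreviation "U \<equiv> antideriv v"
abbreviation "W \<equiv> antideriv U"

lemma U: "(U has_vector_derivative v x) (at x)" by (rule antideriv[OF cont])
lemma W: "(W has_vector_derivative U x) (at x)"
  by (rule antideriv[OF continuous_on_antideriv[OF cont]])
lemma cont_U: "continuous_on S U" by (rule continuous_on_antideriv[OF cont])
lemma cont_W: "continuous_on S W" by (rule continuous_on_antideriv[OF cont_U])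

text \<open>Symmetric second differences of \<open>v\<close>, \<open>U\<close>, \<open>W\<close> and
  central first differences of \<open>v\<close>, \<open>U\<close>. They annihilate the integration
  constants left open by \<open>antideriv\<close>, including the linear function by which
  \<open>W\<close> may change. \<open>d2 x y\<close> is the integral of \<open>v\<close> against the
  tent of height \<open>y\<close> on [x - y, x + y], whose mass is y^2.\<close>

definition "d0 x y = v (x + y) - 2 * v x + v (x - y)"
definition "d1 x y = U (x + y) - 2 * U x + U (x - y)"
definition "d2 x y = W (x + y) - 2 * W x + W (x - y)"
definition "e0 x y = v (x + y) - v (x - y)"
definition "e1 x y = U (x + y) - U (x - y)"
definition "dm x y = Re (v (x + y)) - Re (v (x - y))"

lemmas shifted_derivs =
  has_vector_derivative_shift[OF U] has_vector_derivative_reflect[OF U]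
  has_vector_derivative_shift'[OF U] has_vector_derivative_shift_diff[OF U]
  has_vector_derivative_shift[OF W] has_vector_derivative_reflect[OF W]
  has_vector_derivative_shift'[OF W] has_vector_derivative_shift_diff[OF W]

lemma d1_deriv_y: "(d1 x has_vector_derivative e0 x y) (at y)"
  unfolding d1_def[abs_def] e0_def
  by (auto intro!: derivative_eq_intros shifted_derivs)

lemma d2_deriv_y: "(d2 x has_vector_derivative e1 x y) (at y)"
  unfolding d2_def[abs_def] e1_def
  by (auto intro!: derivative_eq_intros shifted_derivs)

lemma e1_deriv_y: "(e1 x has_vector_derivative (v (x + y) + v (x - y))) (at y)"
  unfolding e1_def[abs_def]
  by (auto intro!: derivative_eq_intros shifted_derivs)

lemma d1_deriv_x: "((\<lambda>x. d1 x y) has_vector_derivative d0 x y) (at x)"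
  unfolding d1_def d0_def
  by (auto intro!: derivative_eq_intros shifted_derivs U W)

lemma d2_deriv_x: "((\<lambda>x. d2 x y) has_vector_derivative d1 x y) (at x)"
  unfolding d1_def d2_def
  by (auto intro!: derivative_eq_intros shifted_derivs U W)

lemma dm_mono: "0 \<le> s \<Longrightarrow> s \<le> y \<Longrightarrow> dm x s \<le> dm x y"
  using Re_mono[of "x + s" "x + y"] Re_mono[of "x - y" "x - s"] by (simp add: dm_def)

lemma dm_le: "0 \<le> y \<Longrightarrow> 0 \<le> dm x y" "dm x y \<le> cmod (e0 x y)"
  using Re_mono[of "x - y" "x + y"] complex_Re_le_cmod[of "e0 x y"] by (auto simp: dm_def e0_def)

lemma d0_le: "0 \<le> y \<Longrightarrow> 20 * cmod (d0 x y) \<le> dm x y"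
  using zyg[of y x] by (cases "y = 0") (auto simp: d0_def dm_def)

lemma norm_diff_le:
  fixes F :: "real \<Rightarrow> complex"
  assumes "0 \<le> y" "0 < c" "\<And>s. (F has_vector_derivative F' s) (at s)"
    and b: "\<And>s. 0 \<le> s \<Longrightarrow> s \<le> y \<Longrightarrow> c * cmod (F' s) \<le> B"
  shows "c * cmod (F y - F 0) \<le> B * y"
proof (cases "y = 0")
  case False
  have "norm (F y - F 0) \<le> B / c * y - B / c * 0"
  proof (rule differentiable_bound_general[where f'=F' and \<phi>'="\<lambda>_. B / c"])
    show "continuous_on {0..y} F"
      using assms(3) by (intro continuous_at_imp_continuous_on ballI has_vector_derivative_continuous)
    show "norm (F' s) \<le> B / c" if "0 < s" "s < y" for s
      using b[of s] that \<open>0 < c\<close> by (simp add: pos_le_divide_eq mult.commute)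
  qed (use assms(1-3) False in \<open>auto intro!: derivative_eq_intros continuous_intros\<close>)
  then show ?thesis using \<open>0 < c\<close> by (simp add: pos_le_divide_eq mult.commute)
qed simp

text \<open>Pairing \<open>t\<close> with \<open>y - t\<close> turns \<open>e0 x t + e0 x (y - t) - e0 x y\<close> into second differences
  of \<open>v\<close> sharing a midpoint, so no pointwise distance of \<open>v\<close> to affine maps is needed.\<close>
lemma d1_estimate:
  assumes y: "0 \<le> y"
  shows "10 * cmod (2 * d1 x y - y *\<^sub>R e0 x y) \<le> dm x y * y"
proof -
  \<comment> \<open>\<open>P\<close> is an antiderivative in \<open>t\<close> of the symmetrised
    expression e0 x t + e0 x (y - t) - e0 x y; over [0, y] it increases by exactly the quantity to
    be estimated.\<close>
  define P where "P t = d1 x t - d1 x (y - t) - t *\<^sub>R e0 x y" for t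
  have P': "(P has_vector_derivative (e0 x t + e0 x (y - t) - e0 x y)) (at t)" for t
    unfolding P_def[abs_def]
    by (auto intro!: derivative_eq_intros d1_deriv_y has_vector_derivative_reflect[OF d1_deriv_y])
  have "10 * cmod (e0 x t + e0 x (y - t) - e0 x y) \<le> dm x y" if "0 \<le> t" "t \<le> y" for t
  proof -
    \<comment> \<open>Two nested pairs with common midpoint M: each second difference about M costs
      1/20 of its own real increment, and the inner increment is at most the outer one, so together
      they cost 1/10.\<close>
    have *: "10 * cmod (v a + v b - (v c + v d)) \<le> Re (v d) - Re (v c)"
      if h: "c \<le> a" "a \<le> b" "b \<le> d" "a + b = c + d" for a b c d
    proof -
      define M where "M = (a + b) / 2"
      have e: "a = M - (b - a)/2" "b = M + (b - a)/2" "c = M - (d - c)/2" "d = M + (d - c)/2"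
        using h(4) by (simp_all add: M_def field_simps)
      have "v a + v b - (v c + v d) = d0 M ((b - a)/2) - d0 M ((d - c)/2)"
        unfolding d0_def e[symmetric] by simp
      then have "20 * cmod (v a + v b - (v c + v d)) \<le> dm M ((b - a)/2) + dm M ((d - c)/2)"
        using norm_triangle_ineq4[of "d0 M ((b - a)/2)" "d0 M ((d - c)/2)"]
          d0_le[of "(b-a)/2" M] d0_le[of "(d-c)/2" M] h by simp
      also have "dm M ((b - a)/2) \<le> dm M ((d - c)/2)" using h by (intro dm_mono) auto
      also have "dm M ((d - c)/2) = Re (v d) - Re (v c)" unfolding dm_def e(3,4)[symmetric] ..
      finally show ?thesis by simp
    qed
    have h: "10 * cmod (v p + v q - (v x + v (x + y))) \<le> Re (v (x + y)) - Re (v x)"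
      if "p = x + t" "q = x + (y - t)" for p q
      using *[of x p q "x + y"] *[of x q p "x + y"] that \<open>0 \<le> t\<close> \<open>t \<le> y\<close>
      by (cases "p \<le> q") (auto simp: add.commute)
    have h': "10 * cmod (v p + v q - (v (x - y) + v x)) \<le> Re (v x) - Re (v (x - y))"
      if "p = x - t" "q = x - (y - t)" for p q
      using *[of "x - y" p q x] *[of "x - y" q p x] that \<open>0 \<le> t\<close> \<open>t \<le> y\<close>
      by (cases "p \<le> q") (auto simp: add.commute)
    have "e0 x t + e0 x (y - t) - e0 x y = (v (x + t) + v (x + (y - t)) - (v x + v (x + y)))
        - (v (x - t) + v (x - (y - t)) - (v (x - y) + v x))" by (simp add: e0_def)
    then have "cmod (e0 x t + e0 x (y - t) - e0 x y) \<le> cmod (v (x + t) + v (x + (y - t)) - (v x + v (x + y)))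
        + cmod (v (x - t) + v (x - (y - t)) - (v (x - y) + v x))" by (simp only: norm_triangle_ineq4)
    then show ?thesis using h[OF refl refl] h'[OF refl refl] unfolding dm_def by linarith
  qed
  from norm_diff_le[OF y _ P' this] have "10 * cmod (P y - P 0) \<le> dm x y * y" by simp
  moreover have "P y - P 0 = 2 * d1 x y - y *\<^sub>R e0 x y" by (simp add: P_def d1_def)
  ultimately show ?thesis by simp
qed

text \<open>In the variable \<open>y\<close>, e1 - 2 y v x has derivative \<open>d0\<close>, and d2
  - y^2 v x has derivative e1 - 2 y v x; all vanish at 0. Integrating the bound on \<open>d0\<close>
  twice, with \<open>dm x t\<close> replaced by the larger \<open>dm x y\<close>, gives both
  claims.\<close>

lemma d2_estimate:
  assumes y: "0 \<le> y"
  shows "20 * cmod (e1 x y - (2 * y) *\<^sub>R v x) \<le> dm x y * y"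
    and "20 * cmod (d2 x y - y\<^sup>2 *\<^sub>R v x) \<le> dm x y * y\<^sup>2"
proof -
  have A: "20 * cmod (e1 x s - (2 * s) *\<^sub>R v x) \<le> dm x y * s" if s: "0 \<le> s" "s \<le> y" for s
  proof -
    have "((\<lambda>t. e1 x t - (2 * t) *\<^sub>R v x) has_vector_derivative d0 x t) (at t)" for t
      by (auto intro!: derivative_eq_intros e1_deriv_y simp: d0_def scaleR_conv_of_real)
    then have "20 * cmod (e1 x s - (2 * s) *\<^sub>R v x - (e1 x 0 - (2 * 0) *\<^sub>R v x)) \<le> dm x y * s"
    proof (rule norm_diff_le[OF s(1), of 20, rotated])
      fix t assume t: "0 \<le> t" "t \<le> s"
      have "20 * cmod (d0 x t) \<le> dm x t" using t d0_le by blast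
      also have "\<dots> \<le> dm x y" using t s dm_mono[of t y x] by simp
      finally show "20 * cmod (d0 x t) \<le> dm x y" .
    qed simp
    then show ?thesis by (simp add: e1_def)
  qed
  show "20 * cmod (e1 x y - (2 * y) *\<^sub>R v x) \<le> dm x y * y" using A[of y] y by simp
  have "((\<lambda>t. d2 x t - t\<^sup>2 *\<^sub>R v x) has_vector_derivative (e1 x t - (2 * t) *\<^sub>R v x)) (at t)" for t
    by (auto intro!: derivative_eq_intros d2_deriv_y)
  then have "20 * cmod (d2 x y - y\<^sup>2 *\<^sub>R v x - (d2 x 0 - 0\<^sup>2 *\<^sub>R v x)) \<le> dm x y * y * y"
  proof (rule norm_diff_le[OF y, of 20, rotated])
    fix t assume t: "0 \<le> t" "t \<le> y"
    have "20 * cmod (e1 x t - (2 * t) *\<^sub>R v x) \<le> dm x y * t" using t A by blast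
    also have "\<dots> \<le> dm x y * y" using t dm_le(1)[OF y, of x] by (intro mult_left_mono) auto
    finally show "20 * cmod (e1 x t - (2 * t) *\<^sub>R v x) \<le> dm x y * y" .
  qed simp
  then show "20 * cmod (d2 x y - y\<^sup>2 *\<^sub>R v x) \<le> dm x y * y\<^sup>2" by (simp add: d2_def power2_eq_square mult.assoc)
qed

text \<open>With \<open>V x y = d2 x y / y\<^sup>2\<close>, the average of \<open>v\<close> on \<open>[x - y, x + y]\<close> against the tent
  kernel, the extension below is \<open>V + \<i> y V\<^sub>x\<close>, and \<open>cK = V\<^sub>x\<close>, \<open>cJ = y V\<^sub>x\<^sub>x\<close>, \<open>cG = V\<^sub>y\<close>,
  \<open>cL - 2 cK = y V\<^sub>x\<^sub>y\<close>.\<close>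
definition "cL x y = (1 / y) *\<^sub>R e0 x y"
definition "cJ x y = (1 / y) *\<^sub>R d0 x y"
definition "cK x y = (1 / y\<^sup>2) *\<^sub>R d1 x y"
definition "cG x y = (1 / y\<^sup>2) *\<^sub>R e1 x y - (2 / y^3) *\<^sub>R d2 x y"

lemma quotient_estimates_pos:
  assumes y: "0 < y"
  shows "20 * (y * cmod (cG x y)) \<le> 3 * dm x y"
    and "10 * (y * cmod (2 * cK x y - cL x y)) \<le> dm x y"
    and "20 * (y * cmod (cJ x y)) \<le> dm x y"
    and "y * Re (cL x y) = dm x y"
    and "y * cmod (cL x y) = cmod (e0 x y)"
proof -
  define A where "A = e1 x y - (2 * y) *\<^sub>R v x"
  define Z where "Z = d2 x y - y\<^sup>2 *\<^sub>R v x"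
  have "20 * cmod A \<le> dm x y * y" "20 * cmod Z \<le> dm x y * y\<^sup>2"
    using d2_estimate[of y x] y by (simp_all add: A_def Z_def)
  then have AZ: "20 * (cmod A / y) \<le> dm x y" "20 * (cmod Z / y\<^sup>2) \<le> dm x y"
    using y by (simp_all add: pos_divide_le_eq)
  \<comment> \<open>The main terms 2 y v x of \<open>e1\<close> and y^2 v x of \<open>d2\<close>
    cancel, as they must since the mean of a constant does not depend on \<open>y\<close>. Only the
    errors \<open>A\<close> and \<open>Z\<close> remain, with weights 1 and 2, hence the factor
    3.\<close>
  have "y *\<^sub>R cG x y = (1 / y) *\<^sub>R A - (2 / y\<^sup>2) *\<^sub>R Z"
    using y by (simp add: cG_def A_def Z_def scaleR_right_diff_distrib power2_eq_square power3_eq_cube)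
  then have "y * cmod (cG x y) = cmod ((1 / y) *\<^sub>R A - (2 / y\<^sup>2) *\<^sub>R Z)"
    using y by (metis abs_of_pos norm_scaleR)
  also have "\<dots> \<le> cmod ((1 / y) *\<^sub>R A) + cmod ((2 / y\<^sup>2) *\<^sub>R Z)" by (rule norm_triangle_ineq4)
  also have "\<dots> = cmod A / y + 2 * (cmod Z / y\<^sup>2)" using y by simp
  finally show "20 * (y * cmod (cG x y)) \<le> 3 * dm x y" using AZ by argo
  have "y *\<^sub>R (2 * cK x y - cL x y) = (1 / y) *\<^sub>R (2 * d1 x y - y *\<^sub>R e0 x y)"
    using y by (simp add: cK_def cL_def scaleR_right_diff_distrib power2_eq_square)
  then have "y * cmod (2 * cK x y - cL x y) = cmod ((1 / y) *\<^sub>R (2 * d1 x y - y *\<^sub>R e0 x y))"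
    using y by (metis abs_of_pos norm_scaleR)
  also have "\<dots> = cmod (2 * d1 x y - y *\<^sub>R e0 x y) / y" using y by simp
  finally show "10 * (y * cmod (2 * cK x y - cL x y)) \<le> dm x y"
    using d1_estimate[of y x] y by (simp add: pos_divide_le_eq)
  show "20 * (y * cmod (cJ x y)) \<le> dm x y" using d0_le[of y x] y by (simp add: cJ_def)
  show "y * Re (cL x y) = dm x y" using y by (simp add: cL_def dm_def e0_def)
  show "y * cmod (cL x y) = cmod (e0 x y)" using y by (simp add: cL_def)
qed

text \<open>The tent mean is even in \<open>y\<close>, so derivatives carry a parity. This transfers
  every estimate from the upper to the lower half plane.\<close>

lemma quotients_abs:
  "cmod (cG x y) = cmod (cG x \<bar>y\<bar>)" "cmod (cJ x y) = cmod (cJ x \<bar>y\<bar>)"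
  "cK x y = cK x \<bar>y\<bar>" "cL x y = cL x \<bar>y\<bar>"
proof -
  have "cG x (- y) = - cG x y" for y
    by (simp add: cG_def e1_def d2_def algebra_simps)
  moreover have "cJ x (- y) = - cJ x y" for y
    by (simp add: cJ_def d0_def algebra_simps)
  ultimately show "cmod (cG x y) = cmod (cG x \<bar>y\<bar>)" "cmod (cJ x y) = cmod (cJ x \<bar>y\<bar>)"
    by (simp_all add: abs_if)
  have "cK x (- y) = cK x y" for y
    by (simp add: cK_def d1_def algebra_simps)
  moreover have "cL x (- y) = cL x y" for y
    by (simp add: cL_def e0_def algebra_simps)
  ultimately show "cK x y = cK x \<bar>y\<bar>" "cL x y = cL x \<bar>y\<bar>"
    by (simp_all add: abs_if)
qed

lemma e0_le: "0 \<le> y \<Longrightarrow> cmod (e0 x y) \<le> 8 * C * (y powr (3/4) + y)"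
proof -
  assume y: "0 \<le> y"
  have "(2::real) powr (3/4) \<le> 2 powr 1" by (intro powr_mono) auto
  then have p: "(2 * y) powr (3/4) \<le> 2 * y powr (3/4)"
    using y by (simp add: powr_mult mult_right_mono)
  have xy: "x + y = (x - y) + 2 * y" by simp
  have "cmod (e0 x y) = cmod (v ((x - y) + 2 * y) - v (x - y))" unfolding e0_def xy[symmetric] ..
  also have "\<dots> \<le> 4 * C * ((2 * y) powr (3/4) + 2 * y)" using y by (intro holder) simp
  also have "\<dots> \<le> 4 * C * (2 * y powr (3/4) + 2 * y)" using p C_nonneg by (intro mult_left_mono) auto
  finally show ?thesis by (simp add: algebra_simps)
qed

lemma cL_le: "y \<noteq> 0 \<Longrightarrow> cmod (cL x y) \<le> 8 * C * (\<bar>y\<bar> powr (-1/4) + 1)"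
proof -
  assume y: "y \<noteq> 0"
  have "\<bar>y\<bar> * cmod (cL x y) \<le> 8 * C * (\<bar>y\<bar> powr (3/4) + \<bar>y\<bar>)"
    using quotient_estimates_pos(5)[of "\<bar>y\<bar>" x] e0_le[of "\<bar>y\<bar>" x] quotients_abs(4)[of x y] y by simp
  also have "\<dots> = \<bar>y\<bar> * (8 * C * (\<bar>y\<bar> powr (-1/4) + 1))"
    using powr_three_quarters[of "\<bar>y\<bar>"] y by (simp add: algebra_simps)
  finally show ?thesis using y by simp
qed

text \<open>Here the norm of \<open>cL\<close> is the gauge in place of \<open>dm\<close>: this form
  feeds the growth bounds near the axis, whereas the distortion estimate needs \<open>dm\<close>,
  the real part.\<close>

lemma quotients_le:
  assumes y: "y \<noteq> 0"
  shows "20 * cmod (cG x y) \<le> 3 * cmod (cL x y)"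
    and "10 * cmod (2 * cK x y - cL x y) \<le> cmod (cL x y)"
    and "20 * cmod (cJ x y) \<le> cmod (cL x y)"
    and "cmod (cK x y) \<le> cmod (cL x y)"
proof -
  let ?n = "\<bar>y\<bar>"
  have n: "0 < ?n" using y by simp
  have d: "dm x ?n \<le> ?n * cmod (cL x y)"
    using quotient_estimates_pos(5)[OF n, of x] dm_le(2)[of x ?n] quotients_abs(4)[of x y] by simp
  note q = quotient_estimates_pos[OF n, of x, folded quotients_abs]
  have "?n * (20 * cmod (cG x y)) \<le> ?n * (3 * cmod (cL x y))"
    using q(1) d by argo
  then show "20 * cmod (cG x y) \<le> 3 * cmod (cL x y)" using n by (simp only: mult_le_cancel_left_pos)
  have "?n * (10 * cmod (2 * cK x y - cL x y)) \<le> ?n * cmod (cL x y)" using q(2) d by argo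
  then show *: "10 * cmod (2 * cK x y - cL x y) \<le> cmod (cL x y)" using n by (simp only: mult_le_cancel_left_pos)
  have "?n * (20 * cmod (cJ x y)) \<le> ?n * cmod (cL x y)" using q(3) d by argo
  then show "20 * cmod (cJ x y) \<le> cmod (cL x y)" using n by (simp only: mult_le_cancel_left_pos)
  have "2 * cmod (cK x y) = cmod ((2 * cK x y - cL x y) + cL x y)" by (simp add: norm_mult)
  also have "\<dots> \<le> cmod (2 * cK x y - cL x y) + cmod (cL x y)" by (rule norm_triangle_ineq)
  finally show "cmod (cK x y) \<le> cmod (cL x y)" using * norm_ge_zero[of "cL x y"] by argo
qed

section \<open>The extension, its weak derivatives and its distortion\<close>

definition ext :: "complex \<Rightarrow> complex" where
  "ext z = (if Im z = 0 then v (Re z)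
     else (1 / (Im z)\<^sup>2) *\<^sub>R d2 (Re z) (Im z) + \<i> * ((1 / Im z) *\<^sub>R d1 (Re z) (Im z)))"

definition ext_x :: "complex \<Rightarrow> complex" where
  "ext_x z = cK (Re z) (Im z) + \<i> * cJ (Re z) (Im z)"

text \<open>The factor of \<open>\<i>\<close> is the \<open>y\<close>-derivative of y V_x, namely
  V_x + y V_xy = cK + (cL - 2 cK).\<close>

definition ext_y :: "complex \<Rightarrow> complex" where
  "ext_y z = cG (Re z) (Im z) + \<i> * (cL (Re z) (Im z) - cK (Re z) (Im z))"

lemma ext_of_real: "ext (of_real x) = v x"
  by (simp add: ext_def)

lemma ext_deriv_x:
  assumes "y \<noteq> 0"
  shows "((\<lambda>x. ext (Complex x y)) has_vector_derivative ext_x (Complex x y)) (at x)"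
  using assms unfolding ext_def ext_x_def cK_def cJ_def
  by (auto intro!: derivative_eq_intros d1_deriv_x d2_deriv_x)

lemma ext_deriv_y:
  assumes "y \<noteq> 0"
  shows "((\<lambda>y. ext (Complex x y)) has_vector_derivative ext_y (Complex x y)) (at y)"
proof -
  have 1: "((\<lambda>s::real. 1 / s\<^sup>2) has_field_derivative (- 2 / y^3)) (at y)"
    and 2: "((\<lambda>s::real. 1 / s) has_field_derivative (- 1 / y\<^sup>2)) (at y)"
    using assms by (auto intro!: derivative_eq_intros simp: power2_eq_square power3_eq_cube power4_eq_xxxx field_simps)
  have "((\<lambda>s. (1 / s\<^sup>2) *\<^sub>R d2 x s + \<i> * ((1 / s) *\<^sub>R d1 x s)) has_vector_derivative
     ((1 / y\<^sup>2) *\<^sub>R e1 x y + (- 2 / y^3) *\<^sub>R d2 x y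
      + \<i> * ((1 / y) *\<^sub>R e0 x y + (- 1 / y\<^sup>2) *\<^sub>R d1 x y))) (at y)"
    by (intro has_vector_derivative_add has_vector_derivative_mult_right has_vector_derivative_scaleR
        d1_deriv_y d2_deriv_y 1 2)
  moreover have "(1 / y\<^sup>2) *\<^sub>R e1 x y + (- 2 / y^3) *\<^sub>R d2 x y
      + \<i> * ((1 / y) *\<^sub>R e0 x y + (- 1 / y\<^sup>2) *\<^sub>R d1 x y) = ext_y (Complex x y)"
    by (simp add: ext_y_def cG_def cL_def cK_def)
  ultimately have "((\<lambda>s. (1 / s\<^sup>2) *\<^sub>R d2 x s + \<i> * ((1 / s) *\<^sub>R d1 x s)) has_vector_derivative ext_y (Complex x y)) (at y)"
    by simp
  then show ?thesis
    by (rule has_vector_derivative_transform_within_open[where S="- {0}"])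
      (use assms in \<open>auto simp: ext_def\<close>)
qed

text \<open>Both the deviation of the tent mean from \<open>v\<close> and the term y V_x are at most
  the norm of \<open>e0 x |y|\<close>, which the Hoelder bound controls. This gives continuity at
  the axis.\<close>

lemma ext_near_axis: "cmod (ext z - v (Re z)) \<le> 16 * C * (\<bar>Im z\<bar> powr (3/4) + \<bar>Im z\<bar>)"
proof (cases "Im z = 0")
  case False
  define x where "x = Re z"
  define y where "y = Im z"
  have y: "y \<noteq> 0" "0 < \<bar>y\<bar>" using False by (auto simp: y_def)
  have e: "20 * cmod (d2 x \<bar>y\<bar> - y\<^sup>2 *\<^sub>R v x) \<le> dm x \<bar>y\<bar> * y\<^sup>2"
    using d2_estimate(2)[of "\<bar>y\<bar>" x] by simp
  have d2: "d2 x \<bar>y\<bar> = d2 x y" by (auto simp: d2_def abs_if)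
  have "(1 / y\<^sup>2) *\<^sub>R d2 x y - v x = (1 / y\<^sup>2) *\<^sub>R (d2 x y - y\<^sup>2 *\<^sub>R v x)"
    using y by (simp add: scaleR_right_diff_distrib)
  then have "cmod ((1 / y\<^sup>2) *\<^sub>R d2 x y - v x) = cmod (d2 x y - y\<^sup>2 *\<^sub>R v x) / y\<^sup>2"
    by simp
  also have "\<dots> \<le> dm x \<bar>y\<bar>"
  proof -
    have "cmod (d2 x y - y\<^sup>2 *\<^sub>R v x) \<le> dm x \<bar>y\<bar> * y\<^sup>2"
      using e norm_ge_zero[of "d2 x y - y\<^sup>2 *\<^sub>R v x"] unfolding d2 by argo
    then show ?thesis using y by (simp add: pos_divide_le_eq)
  qed
  also have "\<dots> \<le> cmod (e0 x \<bar>y\<bar>)" by (rule dm_le(2))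
  also have "\<dots> \<le> 8 * C * (\<bar>y\<bar> powr (3/4) + \<bar>y\<bar>)" by (rule e0_le) simp
  finally have 1: "cmod ((1 / y\<^sup>2) *\<^sub>R d2 x y - v x) \<le> 8 * C * (\<bar>y\<bar> powr (3/4) + \<bar>y\<bar>)" .
  have "(1 / y) *\<^sub>R d1 x y = y *\<^sub>R cK x y" using y by (simp add: cK_def power2_eq_square)
  then have "cmod (\<i> * ((1 / y) *\<^sub>R d1 x y)) = \<bar>y\<bar> * cmod (cK x y)" by (simp add: norm_mult)
  also have "\<dots> \<le> \<bar>y\<bar> * cmod (cL x y)" using quotients_le(4)[OF y(1)] by (intro mult_left_mono) auto
  also have "\<dots> = cmod (e0 x \<bar>y\<bar>)" using quotient_estimates_pos(5)[OF y(2), of x] quotients_abs(4)[of x y] by simp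
  also have "\<dots> \<le> 8 * C * (\<bar>y\<bar> powr (3/4) + \<bar>y\<bar>)" by (rule e0_le) simp
  finally have 2: "cmod (\<i> * ((1 / y) *\<^sub>R d1 x y)) \<le> 8 * C * (\<bar>y\<bar> powr (3/4) + \<bar>y\<bar>)" .
  have "ext z - v x = ((1 / y\<^sup>2) *\<^sub>R d2 x y - v x) + \<i> * ((1 / y) *\<^sub>R d1 x y)"
    using False by (simp add: ext_def x_def y_def)
  then have "cmod (ext z - v x) \<le> cmod ((1 / y\<^sup>2) *\<^sub>R d2 x y - v x) + cmod (\<i> * ((1 / y) *\<^sub>R d1 x y))"
    by (metis norm_triangle_ineq)
  then show ?thesis using 1 2 unfolding x_def y_def by argo
qed (simp add: ext_def)

lemma continuous_diffs:
  assumes "continuous_on S f" "continuous_on S g"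
  shows "continuous_on S (\<lambda>z. d0 (f z) (g z))" "continuous_on S (\<lambda>z. d1 (f z) (g z))"
    "continuous_on S (\<lambda>z. d2 (f z) (g z))" "continuous_on S (\<lambda>z. e0 (f z) (g z))"
    "continuous_on S (\<lambda>z. e1 (f z) (g z))"
  unfolding d0_def d1_def d2_def e0_def e1_def
  by (intro continuous_intros continuous_on_compose2[OF cont] continuous_on_compose2[OF cont_U[of UNIV]]
      continuous_on_compose2[OF cont_W[of UNIV]] assms; simp)+

lemma continuous_ext: "continuous_on UNIV ext"
proof -
  have "isCont ext a" for a
  proof (cases "Im a = 0")
    case False
    have o: "open {z. Im z \<noteq> 0}"
      by (intro open_Collect_neq continuous_intros)
    have "continuous_on {z. Im z \<noteq> 0} (\<lambda>z. (1 / (Im z)\<^sup>2) *\<^sub>R d2 (Re z) (Im z) + \<i> * ((1 / Im z) *\<^sub>R d1 (Re z) (Im z)))"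
      by (intro continuous_intros continuous_diffs) auto
    then have "continuous_on {z. Im z \<noteq> 0} ext"
      by (rule continuous_on_eq) (simp add: ext_def)
    then show ?thesis using o False continuous_on_eq_continuous_at by blast
  next
    case True
    have "((\<lambda>z. ext z - v (Re z)) \<longlongrightarrow> 0) (at a)"
    proof (rule Lim_null_comparison)
      show "\<forall>\<^sub>F z in at a. cmod (ext z - v (Re z)) \<le> 16 * C * (\<bar>Im z\<bar> powr (3/4) + \<bar>Im z\<bar>)"
        using ext_near_axis by simp
      have "((\<lambda>z. \<bar>Im z\<bar>) \<longlongrightarrow> \<bar>Im a\<bar>) (at a)" by (intro tendsto_intros)
      then have "((\<lambda>z. 16 * C * (\<bar>Im z\<bar> powr (3/4) + \<bar>Im z\<bar>)) \<longlongrightarrow> 16 * C * (\<bar>Im a\<bar> powr (3/4) + \<bar>Im a\<bar>)) (at a)"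
        by (intro tendsto_intros tendsto_powr') auto
      then show "((\<lambda>z. 16 * C * (\<bar>Im z\<bar> powr (3/4) + \<bar>Im z\<bar>)) \<longlongrightarrow> 0) (at a)" using True by simp
    qed
    moreover have "((\<lambda>z. v (Re z)) \<longlongrightarrow> v (Re a)) (at a)"
      using cont by (intro isCont_tendsto_compose[where g=v] tendsto_intros) (auto simp: continuous_on_eq_continuous_at)
    ultimately have "((\<lambda>z. (ext z - v (Re z)) + v (Re z)) \<longlongrightarrow> 0 + v (Re a)) (at a)" by (rule tendsto_add)
    moreover have "ext a = v (Re a)" using True by (simp add: ext_def)
    ultimately show ?thesis by (simp add: isCont_def)
  qed
  then show ?thesis by (simp add: continuous_at_imp_continuous_on)
qed

lemma ext_x_le: "cmod (ext_x z) \<le> 16 * C * (\<bar>Im z\<bar> powr (-1/4) + 1)"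
  and ext_y_le: "cmod (ext_y z) \<le> 16 * C * (\<bar>Im z\<bar> powr (-1/4) + 1)"
proof -
  define x where "x = Re z"
  define y where "y = Im z"
  have "cmod (ext_x z) \<le> 2 * cmod (cL x y) \<and> cmod (ext_y z) \<le> 2 * cmod (cL x y)" if y: "y \<noteq> 0"
  proof -
    note q = quotients_le[OF y, of x] norm_ge_zero[of "cL x y"]
    have "cmod (ext_x z) \<le> cmod (cK x y) + cmod (cJ x y)"
      using norm_triangle_ineq[of "cK x y" "\<i> * cJ x y"] by (simp add: ext_x_def x_def y_def norm_mult)
    moreover have "2 * cmod (cL x y - cK x y) = cmod ((2 * cK x y - cL x y) + (- cL x y))"
    proof -
      have "2 * (cL x y - cK x y) = - ((2 * cK x y - cL x y) + (- cL x y))" by simp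
      then show ?thesis by (metis norm_minus_cancel norm_mult norm_numeral)
    qed
    then have "2 * cmod (cL x y - cK x y) \<le> cmod (2 * cK x y - cL x y) + cmod (cL x y)"
      using norm_triangle_ineq[of "2 * cK x y - cL x y" "- cL x y"] by simp
    moreover have "cmod (ext_y z) \<le> cmod (cG x y) + cmod (cL x y - cK x y)"
      using norm_triangle_ineq[of "cG x y" "\<i> * (cL x y - cK x y)"] by (simp add: ext_y_def x_def y_def norm_mult)
    ultimately show ?thesis using q by argo
  qed
  moreover have "2 * cmod (cL x y) \<le> 16 * C * (\<bar>y\<bar> powr (-1/4) + 1)" if y: "y \<noteq> 0"
    using cL_le[OF y, of x] by simp
  \<comment> \<open>Division by zero yields 0, so the bounds hold on the axis too, as
    \<open>L2loc_of_bound\<close> demands.\<close>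
  moreover have "ext_x z = 0" "ext_y z = 0" if "y = 0"
    using that by (auto simp: ext_x_def ext_y_def y_def cK_def cJ_def cG_def cL_def)
  ultimately show "cmod (ext_x z) \<le> 16 * C * (\<bar>Im z\<bar> powr (-1/4) + 1)"
    and "cmod (ext_y z) \<le> 16 * C * (\<bar>Im z\<bar> powr (-1/4) + 1)"
    unfolding y_def[symmetric] using C_nonneg by (cases "y = 0"; fastforce)+
qed

lemma borel_ext_xy: "ext_x \<in> borel_measurable borel" "ext_y \<in> borel_measurable borel"
proof -
  have [measurable]: "Re \<in> borel_measurable borel" "Im \<in> borel_measurable borel"
    "(\<lambda>z. d0 (Re z) (Im z)) \<in> borel_measurable borel" "(\<lambda>z. d1 (Re z) (Im z)) \<in> borel_measurable borel"
    "(\<lambda>z. d2 (Re z) (Im z)) \<in> borel_measurable borel" "(\<lambda>z. e0 (Re z) (Im z)) \<in> borel_measurable borel"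
    "(\<lambda>z. e1 (Re z) (Im z)) \<in> borel_measurable borel"
    by (auto intro!: borel_measurable_continuous_onI continuous_diffs continuous_intros)
  show "ext_x \<in> borel_measurable borel" "ext_y \<in> borel_measurable borel"
    unfolding ext_x_def[abs_def] ext_y_def[abs_def] cK_def cJ_def cG_def cL_def by measurable
qed

text \<open>Horizontal segments keep their distance from the axis, so the derivative bound is
  constant along them. Vertical ones may cross it, which is where
  \<open>singular_derivative_quotient\<close> and its factor 3 enter.\<close>

lemma weak_partial_ext: "weak_partial ext 1 ext_x" "weak_partial ext \<i> ext_y"
proof -
  define K where "K = 16 * C"
  have K: "0 \<le> K" using C_nonneg by (simp add: K_def)
  have z: "z = Complex (Re z) (Im z)" for z by simp
  show "weak_partial ext 1 ext_x"
  proof (rule weak_partial_of_difference_quotients[where D="\<lambda>z. K * (\<bar>Im z\<bar> powr (-1/4) + 1)"])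
    show "AE z in lborel. \<forall>h. 0 < h \<longrightarrow> h \<le> 1 \<longrightarrow>
      cmod (ext z - ext (z - of_real h * 1)) \<le> h * (K * (\<bar>Im z\<bar> powr (-1/4) + 1))"
      using AE_Im_nonzero
    proof (eventually_elim, intro allI impI)
      fix z and h :: real assume y: "Im z \<noteq> 0" and h: "0 < h"
      define B where "B = K * (\<bar>Im z\<bar> powr (-1/4) + 1)"
      have "norm (ext (Complex (Re z) (Im z)) - ext (Complex (Re z - h) (Im z))) \<le> B * Re z - B * (Re z - h)"
      proof (rule differentiable_bound_general[where f="\<lambda>s. ext (Complex s (Im z))" and
            f'="\<lambda>s. ext_x (Complex s (Im z))" and \<phi>="\<lambda>s. B * s" and \<phi>'="\<lambda>_. B"])
        show "continuous_on {Re z - h..Re z} (\<lambda>s. ext (Complex s (Im z)))"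
          using ext_deriv_x[OF y] has_vector_derivative_continuous continuous_at_imp_continuous_on by blast
        show "norm (ext_x (Complex s (Im z))) \<le> B" for s
          using ext_x_le[of "Complex s (Im z)"] by (simp add: B_def K_def)
      qed (use h y in \<open>auto intro!: derivative_eq_intros continuous_intros ext_deriv_x\<close>)
      moreover have "B * Re z - B * (Re z - h) = h * B" by (simp add: algebra_simps)
      moreover have e: "z - of_real h * 1 = Complex (Re z - h) (Im z)" by (simp add: complex_eq_iff)
      ultimately show "cmod (ext z - ext (z - of_real h * 1)) \<le> h * (K * (\<bar>Im z\<bar> powr (-1/4) + 1))"
        unfolding e B_def[symmetric] by simp
    qed
    show "AE z in lborel. ((\<lambda>h. (ext z - ext (z - of_real h * 1)) / of_real h) \<longlongrightarrow> ext_x z) (at_right 0)"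
      using AE_Im_nonzero
    proof eventually_elim
      fix z assume y: "Im z \<noteq> 0"
      have "z - of_real h * 1 = Complex (Re z - h) (Im z)" for h by (simp add: complex_eq_iff)
      then show "((\<lambda>h. (ext z - ext (z - of_real h * 1)) / of_real h) \<longlongrightarrow> ext_x z) (at_right 0)"
        using has_vector_derivative_left_quotient[OF ext_deriv_x[OF y, of "Re z"]] by simp
    qed
  qed (rule continuous_ext borel_ext_xy set_integrable_Im_powr_quarter | simp)+
  show "weak_partial ext \<i> ext_y"
  proof (rule weak_partial_of_difference_quotients[where D="\<lambda>z. 3 * K * (\<bar>Im z\<bar> powr (-1/4) + 1)"])
    show "AE z in lborel. \<forall>h. 0 < h \<longrightarrow> h \<le> 1 \<longrightarrow>
      cmod (ext z - ext (z - of_real h * \<i>)) \<le> h * (3 * K * (\<bar>Im z\<bar> powr (-1/4) + 1))"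
      using AE_Im_nonzero
    proof (eventually_elim, intro allI impI)
      fix z and h :: real assume y: "Im z \<noteq> 0" and h: "0 < h"
      have "z - of_real h * \<i> = Complex (Re z) (Im z - h)" by (simp add: complex_eq_iff)
      moreover have "cmod (ext (Complex (Re z) (Im z)) - ext (Complex (Re z) (Im z - h))) \<le> h * (3 * K * (\<bar>Im z\<bar> powr (-1/4) + 1))"
      proof (rule singular_derivative_quotient[where P="\<lambda>s. ext (Complex (Re z) s)" and P'="\<lambda>s. ext_y (Complex (Re z) s)"])
        have "continuous_on UNIV (\<lambda>s. Complex (Re z) s)"
          unfolding Complex_eq by (intro continuous_intros)
        then show "continuous_on UNIV (\<lambda>s. ext (Complex (Re z) s))"
          by (rule continuous_on_compose2[OF continuous_ext]) auto
        show "cmod (ext_y (Complex (Re z) s)) \<le> K * (\<bar>s\<bar> powr (-1/4) + 1)" for s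
          using ext_y_le[of "Complex (Re z) s"] by (simp add: K_def)
      qed (use h y K in \<open>auto intro!: ext_deriv_y\<close>)
      ultimately show "cmod (ext z - ext (z - of_real h * \<i>)) \<le> h * (3 * K * (\<bar>Im z\<bar> powr (-1/4) + 1))"
        by simp
    qed
    show "AE z in lborel. ((\<lambda>h. (ext z - ext (z - of_real h * \<i>)) / of_real h) \<longlongrightarrow> ext_y z) (at_right 0)"
      using AE_Im_nonzero
    proof eventually_elim
      fix z assume y: "Im z \<noteq> 0"
      have "z - of_real h * \<i> = Complex (Re z) (Im z - h)" for h by (simp add: complex_eq_iff)
      then show "((\<lambda>h. (ext z - ext (z - of_real h * \<i>)) / of_real h) \<longlongrightarrow> ext_y z) (at_right 0)"
        using has_vector_derivative_left_quotient[OF ext_deriv_y[OF y, of "Re z"]] by simp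
    qed
  qed (rule continuous_ext borel_ext_xy set_integrable_Im_powr_quarter | simp)+
qed

text \<open>In f_x + i f_y the derivative V_x cancels; what remains is at most (2 + 1 + 3)/20 of
  dm/|y|. In f_x - i f_y the real part of \<open>cL\<close> equals dm/|y|, and the other terms
  remove at most (1 + 3)/20 of it. The ratio is 6/16 = 3/8.\<close>

lemma reduced_inequality:
  assumes y: "Im z \<noteq> 0"
  shows "cmod ((ext_x z + \<i> * ext_y z) / 2) \<le> 3/8 * Re ((ext_x z - \<i> * ext_y z) / 2)"
proof -
  define x where "x = Re z"
  define y where "y = Im z"
  define n where "n = \<bar>y\<bar>"
  have n: "0 < n" using assms by (simp add: n_def y_def)
  note q = quotient_estimates_pos[OF n, of x, unfolded n_def, folded quotients_abs, folded n_def]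
  have a: "ext_x z + \<i> * ext_y z = (2 * cK x y - cL x y) + \<i> * (cJ x y + cG x y)"
    by (simp add: ext_x_def ext_y_def x_def y_def algebra_simps)
  have b: "ext_x z - \<i> * ext_y z = cL x y + \<i> * (cJ x y - cG x y)"
    by (simp add: ext_x_def ext_y_def x_def y_def algebra_simps)
  have "cmod (ext_x z + \<i> * ext_y z) \<le> cmod (2 * cK x y - cL x y) + (cmod (cJ x y) + cmod (cG x y))"
    unfolding a using norm_triangle_ineq[of "2 * cK x y - cL x y" "\<i> * (cJ x y + cG x y)"]
      norm_triangle_ineq[of "cJ x y" "cG x y"] by (simp add: norm_mult)
  from mult_left_mono[OF this, of n] n
  have 1: "20 * (n * cmod (ext_x z + \<i> * ext_y z)) \<le> 6 * dm x n"
    using q(1-3) by (simp add: distrib_left)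
  have "\<bar>Re (\<i> * (cJ x y - cG x y))\<bar> \<le> cmod (\<i> * (cJ x y - cG x y))" by (rule abs_Re_le_cmod)
  also have "\<dots> \<le> cmod (cJ x y) + cmod (cG x y)" by (simp add: norm_mult norm_triangle_ineq4)
  finally have "Re (cL x y) - (cmod (cJ x y) + cmod (cG x y)) \<le> Re (ext_x z - \<i> * ext_y z)"
    unfolding b by simp
  from mult_left_mono[OF this, of n] n
  have 2: "16 * dm x n \<le> 20 * (n * Re (ext_x z - \<i> * ext_y z))"
    using q(1,3,4) by (simp add: distrib_left right_diff_distrib)
  have "n * (8 * cmod (ext_x z + \<i> * ext_y z)) \<le> n * (3 * Re (ext_x z - \<i> * ext_y z))"
    using 1 2 by argo
  then have "8 * cmod (ext_x z + \<i> * ext_y z) \<le> 3 * Re (ext_x z - \<i> * ext_y z)"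
    using n by (simp only: mult_le_cancel_left_pos)
  then show ?thesis by (simp add: norm_divide)
qed

lemma L2loc_ext: "L2loc ext"
  unfolding L2loc_def
proof (intro conjI allI impI)
  note [measurable] = borel_measurable_continuous_onI[OF continuous_ext]
  show "ext \<in> borel_measurable lebesgue" by (rule measurable_completion) simp
  fix S :: "complex set" assume S: "compact S"
  have "continuous_on S (\<lambda>z. (cmod (ext z))\<^sup>2)"
    by (intro continuous_intros continuous_on_subset[OF continuous_ext]) auto
  then have "integrable lborel (\<lambda>z. indicator S z *\<^sub>R (cmod (ext z))\<^sup>2)"
    using S by (rule borel_integrable_compact[rotated])
  moreover have [measurable]: "S \<in> sets borel" using S by (simp add: compact_imp_closed)
  ultimately show "set_integrable lebesgue S (\<lambda>z. (cmod (ext z))\<^sup>2)"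
    unfolding set_integrable_def by (subst integrable_completion) auto
qed

lemma reduced_qc_ext:
  assumes "v a \<noteq> v b"
  shows "reduced_qc ext"
  unfolding reduced_qc_def
proof (intro conjI)
  show "\<exists>a b. ext a \<noteq> ext b" using assms ext_of_real by metis
  show "W12loc ext" unfolding W12loc_def
    using L2loc_ext weak_partial_ext L2loc_of_bound[OF borel_ext_xy(1) ext_x_le] L2loc_of_bound[OF borel_ext_xy(2) ext_y_le]
    by blast
  have "AE z in lborel. cmod ((ext_x z + \<i> * ext_y z) / 2) \<le> 3/8 * Re ((ext_x z - \<i> * ext_y z) / 2)"
    using AE_Im_nonzero by eventually_elim (rule reduced_inequality)
  then have ae: "AE z in lebesgue. cmod ((ext_x z + \<i> * ext_y z) / 2) \<le> 3/8 * Re ((ext_x z - \<i> * ext_y z) / 2)"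
    by (rule AE_completion)
  show "\<exists>gx gy k. weak_partial ext 1 gx \<and> weak_partial ext \<i> gy \<and> 0 \<le> k \<and> k < 1 \<and>
        (AE z in lebesgue. cmod ((gx z + \<i> * gy z) / 2) \<le> k * Re ((gx z - \<i> * gy z) / 2))"
    by (rule exI[of _ ext_x], rule exI[of _ ext_y], rule exI[of _ "3/8"]) (use weak_partial_ext ae in simp)
qed (rule continuous_ext)

end

section \<open>A martingale curve\<close>

text \<open>The size is dictated by \<open>curve_zygmund\<close>, whose tightest requirement is 82 *
  4 * eta * 6 \<le> 2; at this value the left side is 1.968.\<close>

definition eta :: real where "eta = 1/1000"

text \<open>The increments average to zero, so slopes form a martingale; they vanish for the two
  outer children of a cell, so that adjacent cells with different parents stay comparable.\<close>
definition step :: "int \<Rightarrow> complex" where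
  "step c = (if c = 1 then of_real eta else if c = 2 then - of_real eta
     else if c = 3 then \<i> * of_real eta else if c = 4 then - \<i> * of_real eta else 0)"

text \<open>Sum of \<open>step i\<close> over 0 \<le> i < c: the displacement accumulated before
  child \<open>c\<close>. It vanishes at 0 and at 5.\<close>

definition psum :: "int \<Rightarrow> complex" where
  "psum c = (if c = 2 then of_real eta else if c = 4 then \<i> * of_real eta else 0)"

text \<open>Index \<open>k\<close> at level \<open>n\<close> stands for the cell [k/6^n, (k+1)/6^n]
  of the whole line; \<open>div\<close> rounds downwards, so parents are right for negative
  \<open>k\<close> as well. Scaling the step by the parent's real part makes that real part a
  product of factors 1 \<plusminus> eta and 1, hence positive.\<close>

primrec slope :: "nat \<Rightarrow> int \<Rightarrow> complex" where
  "slope 0 k = 1"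
| "slope (Suc n) k = slope n (k div 6) + of_real (Re (slope n (k div 6))) * step (k mod 6)"

text \<open>These are the values at the points k/6^n of the curve with the prescribed cell slopes;
  see \<open>node_increment\<close> and \<open>curve_node\<close>.\<close>

primrec node :: "nat \<Rightarrow> int \<Rightarrow> complex" where
  "node 0 k = of_int k"
| "node (Suc n) k = node n (k div 6) + (of_int (k mod 6) * slope n (k div 6)
     + of_real (Re (slope n (k div 6))) * psum (k mod 6)) / 6^Suc n"

abbreviation weight :: "nat \<Rightarrow> int \<Rightarrow> real" where
  "weight n k \<equiv> Re (slope n k)"

lemma norm_step_le: "cmod (step c) \<le> eta"
  by (simp add: step_def norm_mult eta_def)

lemma norm_psum_le: "cmod (psum c) \<le> eta"
  by (simp add: psum_def norm_mult eta_def)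

lemma weight_Suc: "weight (Suc n) k = weight n (k div 6) * (1 + Re (step (k mod 6)))"
  by (simp add: algebra_simps)

lemma abs_Re_step_le: "\<bar>Re (step c)\<bar> \<le> eta"
  using abs_Re_le_cmod norm_step_le order_trans by blast

lemma weight_pos: "0 < weight n k"
proof (induction n arbitrary: k)
  case (Suc n)
  have "0 < 1 + Re (step (k mod 6))" using abs_Re_step_le[of "k mod 6"] by (simp add: eta_def abs_le_iff)
  then show ?case unfolding weight_Suc using Suc by simp
qed simp

lemma weight_Suc_bounds:
  "weight (Suc n) k \<le> (1 + eta) * weight n (k div 6)"
  "(1 - eta) * weight n (k div 6) \<le> weight (Suc n) k"
proof -
  have "1 + Re (step (k mod 6)) \<le> 1 + eta" "1 - eta \<le> 1 + Re (step (k mod 6))"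
    using abs_Re_step_le[of "k mod 6"] by (auto simp: abs_le_iff)
  then show "weight (Suc n) k \<le> (1 + eta) * weight n (k div 6)"
    "(1 - eta) * weight n (k div 6) \<le> weight (Suc n) k"
    unfolding weight_Suc using weight_pos[of n "k div 6"] by (simp_all add: mult.commute mult_left_mono)
qed

lemma norm_slope_le: "cmod (slope n k) \<le> 2^n"
proof (induction n arbitrary: k)
  case (Suc n)
  have "cmod (of_real (weight n (k div 6)) * step (k mod 6)) \<le> cmod (slope n (k div 6)) * 1"
    unfolding norm_mult using norm_step_le[of "k mod 6"] abs_Re_le_cmod[of "slope n (k div 6)"]
    by (intro mult_mono) (auto simp: eta_def)
  then have "cmod (slope (Suc n) k) \<le> 2 * cmod (slope n (k div 6))"
    using norm_triangle_ineq[of "slope n (k div 6)" "of_real (weight n (k div 6)) * step (k mod 6)"] by simp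
  also have "\<dots> \<le> 2^Suc n" using Suc[of "k div 6"] by simp
  finally show ?case .
qed simp

lemma mod6_cases:
  fixes k :: int
  obtains "k mod 6 = 5" "(k + 1) div 6 = k div 6 + 1" "(k + 1) mod 6 = 0"
  | "k mod 6 = 0 \<or> k mod 6 = 1 \<or> k mod 6 = 2 \<or> k mod 6 = 3 \<or> k mod 6 = 4"
    "(k + 1) div 6 = k div 6" "(k + 1) mod 6 = k mod 6 + 1"
proof -
  define q where "q = k div 6"
  define r where "r = k mod 6"
  have k: "k = 6 * q + r" "0 \<le> r" "r < 6" by (simp_all add: q_def r_def)
  show ?thesis
  proof (cases "r = 5")
    case True
    then have "k + 1 = 6 * (q + 1) + 0" using k(1) by simp
    then have "(k + 1) div 6 = q + 1" "(k + 1) mod 6 = 0"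
      by (rule int_div_pos_eq int_mod_pos_eq; simp)+
    with True show ?thesis unfolding q_def r_def by (intro that(1))
  next
    case False
    then have c: "r = 0 \<or> r = 1 \<or> r = 2 \<or> r = 3 \<or> r = 4"
      using k(2,3) by auto
    have "k + 1 = 6 * q + (r + 1)" using k(1) by simp
    then have "(k + 1) div 6 = q" "(k + 1) mod 6 = r + 1"
      by (rule int_div_pos_eq int_mod_pos_eq; use False k(2,3) in simp)+
    with c show ?thesis unfolding q_def r_def by (intro that(2))
  qed
qed

text \<open>Between siblings, \<open>psum\<close> grows by \<open>step\<close>. After the last child
  both are 0, so the six increments add up to the parent's increment and the next node is the
  parent's next node.\<close>

lemma node_increment: "node n (k + 1) - node n k = slope n k / 6^n"
proof (induction n arbitrary: k)
  case (Suc n)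
  show ?case
  proof (cases k rule: mod6_cases)
    case 1
    then show ?thesis using Suc[of "k div 6"]
      by (simp add: psum_def step_def field_simps)
  next
    case 2
    then have "psum (k mod 6 + 1) = psum (k mod 6) + step (k mod 6)"
      by (auto simp: psum_def step_def)
    with 2 show ?thesis by (simp add: field_simps)
  qed
qed simp

text \<open>Siblings differ by at most 2 eta times the parent's weight, and passing to a child's
  weight raises 2 to at most 3. Across a parent boundary both cells are outer children with step 0,
  so the parents' estimate is inherited verbatim and the constant does not deteriorate with
  \<open>n\<close>.\<close>

lemma adjacent_slopes:
  "cmod (slope n (k + 1) - slope n k) \<le> 3 * eta * weight n k \<and>
   cmod (slope n (k + 1) - slope n k) \<le> 3 * eta * weight n (k + 1)"
proof (induction n arbitrary: k)
  case 0
  then show ?case by (simp add: eta_def)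
next
  case (Suc n)
  show ?case
  proof (cases k rule: mod6_cases)
    case 1
    then show ?thesis using Suc[of "k div 6"] by (simp add: step_def)
  next
    case 2
    let ?w = "weight n (k div 6)"
    have "slope (Suc n) (k + 1) - slope (Suc n) k = of_real ?w * (step (k mod 6 + 1) - step (k mod 6))"
      using 2 by (simp add: algebra_simps)
    then have "cmod (slope (Suc n) (k + 1) - slope (Suc n) k) = ?w * cmod (step (k mod 6 + 1) - step (k mod 6))"
      using weight_pos[of n "k div 6"] by (simp add: norm_mult)
    also have "\<dots> \<le> ?w * (2 * eta)"
      using weight_pos[of n "k div 6"] norm_triangle_ineq4[of "step (k mod 6 + 1)" "step (k mod 6)"]
        norm_step_le[of "k mod 6 + 1"] norm_step_le[of "k mod 6"] by (intro mult_left_mono) auto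
    finally have *: "cmod (slope (Suc n) (k + 1) - slope (Suc n) k) \<le> 2 * eta * ?w"
      by (simp add: mult.commute del: slope.simps)
    have "2 * eta * ?w \<le> 3 * eta * weight (Suc n) j" if "j div 6 = k div 6" for j
    proof -
      have 1: "(1 - eta) * ?w \<le> weight (Suc n) j" using weight_Suc_bounds(2)[of n j] that by simp
      have "2 * eta * ?w \<le> 3 * eta * ((1 - eta) * ?w)"
        using weight_pos[of n "k div 6"] by (simp add: eta_def)
      also have "\<dots> \<le> 3 * eta * weight (Suc n) j"
        by (rule mult_left_mono[OF 1]) (simp add: eta_def)
      finally show ?thesis .
    qed
    from order_trans[OF * this[OF refl]] order_trans[OF * this[OF 2(2)]] show ?thesis by (rule conjI)
  qed
qed

section \<open>Piecewise affine approximations, their limit and its second differences\<close>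

definition approx :: "nat \<Rightarrow> real \<Rightarrow> complex" where
  "approx n x = node n \<lfloor>6^n * x\<rfloor> + (x - of_int \<lfloor>6^n * x\<rfloor> / 6^n) *\<^sub>R slope n \<lfloor>6^n * x\<rfloor>"

lemma floor_Suc_div: "\<lfloor>6^Suc n * x\<rfloor> div 6 = \<lfloor>6^n * x :: real\<rfloor>"
  using floor_divide_real_eq_div[of 6 "6^Suc n * x"] by simp

lemma cell_bounds:
  "0 \<le> x - of_int \<lfloor>6^n * x\<rfloor> / 6^n" "x - of_int \<lfloor>6^n * x\<rfloor> / 6^n \<le> 1 / (6::real)^n"
proof -
  have 1: "of_int \<lfloor>6^n * x\<rfloor> \<le> 6^n * x" and 2: "6^n * x - of_int \<lfloor>6^n * x\<rfloor> \<le> 1" by linarith+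
  have p: "(0::real) < 6^n" by simp
  show "0 \<le> x - of_int \<lfloor>6^n * x\<rfloor> / 6^n" using 1 p by (simp add: pos_divide_le_eq mult.commute)
  have "x - of_int \<lfloor>6^n * x\<rfloor> / 6^n = (6^n * x - of_int \<lfloor>6^n * x\<rfloor>) / 6^n" using p by (simp add: field_simps)
  also have "\<dots> \<le> 1 / 6^n" by (rule divide_right_mono[OF 2]) simp
  finally show "x - of_int \<lfloor>6^n * x\<rfloor> / 6^n \<le> 1 / (6::real)^n" .
qed

text \<open>On a child cell the correction has two parts, the displacement at its left end and the
  changed slope inside, each at most eta w / 6^(n+1); 2/6 gives the factor 1/3.\<close>

lemma approx_Suc_le:
  "cmod (approx (Suc n) x - approx n x) \<le> eta * (weight n \<lfloor>6^n * x\<rfloor> / 6^n) / 3"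
proof -
  define j where "j = \<lfloor>6^Suc n * x\<rfloor>"
  define k where "k = \<lfloor>6^n * x\<rfloor>"
  define c where "c = j mod 6"
  define r where "r = x - of_int j / 6^Suc n"
  define w where "w = weight n k"
  have k: "j div 6 = k" unfolding j_def k_def by (rule floor_Suc_div)
  have j: "j = 6 * k + c" unfolding c_def k[symmetric] by simp
  have w: "0 < w" unfolding w_def by (rule weight_pos)
  have r: "0 \<le> r" "r \<le> 1 / 6^Suc n"
    unfolding r_def j_def using cell_bounds[of x "Suc n"] by auto
  have rk: "x - of_int k / 6^n = r + of_int c / 6^Suc n"
    unfolding r_def j by (simp add: field_simps)
  have "approx (Suc n) x - approx n x = of_real w * psum c / 6^Suc n + r *\<^sub>R (of_real w * step c)"
    unfolding approx_def j_def[symmetric] k_def[symmetric] r_def[symmetric] rk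
    by (simp add: k c_def[symmetric] w_def[symmetric] scaleR_conv_of_real algebra_simps add_divide_distrib)
  also have "cmod \<dots> \<le> cmod (of_real w * psum c / 6^Suc n) + cmod (r *\<^sub>R (of_real w * step c))"
    by (rule norm_triangle_ineq)
  also have "\<dots> = w * cmod (psum c) / 6^Suc n + r * (w * cmod (step c))"
    using w r by (simp add: norm_mult norm_divide norm_power)
  also have "\<dots> \<le> w * eta / 6^Suc n + (1 / 6^Suc n) * (w * eta)"
    using w r norm_step_le[of c] norm_psum_le[of c]
    by (intro add_mono mult_mono divide_right_mono mult_left_mono) auto
  also have "\<dots> = eta * (w / 6^n) / 3" by (simp add: field_simps)
  finally show ?thesis unfolding w_def k_def .
qed

text \<open>Weight times cell length drops by at least the factor 3 per level, as (1 + eta)/6 \<le>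
  1/3. The constant 1/2 is the fixed point of a = a/3 + 1/3.\<close>

lemma approx_tail:
  "cmod (approx (n + j) x - approx n x) \<le> eta * (weight n \<lfloor>6^n * x\<rfloor> / 6^n) / 2"
proof (induction j arbitrary: n)
  case 0
  then show ?case using weight_pos[of n "\<lfloor>6^n * x\<rfloor>"] by (simp add: eta_def)
next
  case (Suc j)
  let ?w = "weight n \<lfloor>6^n * x\<rfloor> / 6^n"
  have w: "0 \<le> ?w" using weight_pos[of n "\<lfloor>6^n * x\<rfloor>"] by simp
  have "weight (Suc n) \<lfloor>6^Suc n * x\<rfloor> / 6^Suc n \<le> (1 + eta) * weight n \<lfloor>6^n * x\<rfloor> / 6^Suc n"
    using weight_Suc_bounds(1)[of n "\<lfloor>6^Suc n * x\<rfloor>"] unfolding floor_Suc_div by (intro divide_right_mono) auto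
  also have "\<dots> = (1 + eta) / 6 * ?w" by simp
  also have "\<dots> \<le> 1/3 * ?w" using w by (intro mult_right_mono) (auto simp: eta_def)
  finally have 1: "weight (Suc n) \<lfloor>6^Suc n * x\<rfloor> / 6^Suc n \<le> 1/3 * ?w" .
  have "cmod (approx (n + Suc j) x - approx n x)
      \<le> cmod (approx (Suc n + j) x - approx (Suc n) x) + cmod (approx (Suc n) x - approx n x)"
    using norm_triangle_ineq[of "approx (Suc n + j) x - approx (Suc n) x" "approx (Suc n) x - approx n x"] by simp
  also have "\<dots> \<le> eta * (1/3 * ?w) / 2 + eta * ?w / 3"
  proof (rule add_mono)
    have "eta * (weight (Suc n) \<lfloor>6^Suc n * x\<rfloor> / 6^Suc n) / 2 \<le> eta * (1/3 * ?w) / 2"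
      using 1 by (intro divide_right_mono mult_left_mono) (auto simp: eta_def)
    then show "cmod (approx (Suc n + j) x - approx (Suc n) x) \<le> eta * (1/3 * ?w) / 2"
      using Suc[of "Suc n"] by (rule order_trans[rotated])
  qed (rule approx_Suc_le)
  also have "\<dots> = eta * ?w / 2" by simp
  finally show ?case .
qed

lemma weight_ratio_le: "weight n k / 6^n \<le> (1/3)^n"
proof -
  have "weight n k / 6^n \<le> 2^n / 6^n"
    using norm_slope_le[of n k] complex_Re_le_cmod[of "slope n k"] by (intro divide_right_mono) auto
  also have "\<dots> = (2/6)^n" by (rule power_divide[symmetric])
  finally show ?thesis by simp
qed

definition curve :: "real \<Rightarrow> complex" where
  "curve x = lim (\<lambda>n. approx n x)"

lemma approx_tendsto: "(\<lambda>n. approx n x) \<longlonglongrightarrow> curve x"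
proof -
  have "Cauchy (\<lambda>n. approx n x)"
    unfolding Cauchy_altdef2
  proof (intro allI impI)
    fix e :: real assume "0 < e"
    then obtain N where N: "(1/3::real)^N < e" using real_arch_pow_inv[of e "1/3"] by auto
    have "dist (approx n x) (approx N x) < e" if "N \<le> n" for n
    proof -
      obtain j where j: "n = N + j" using le_Suc_ex[OF \<open>N \<le> n\<close>] by blast
      have "dist (approx n x) (approx N x) \<le> eta * (weight N \<lfloor>6^N * x\<rfloor> / 6^N) / 2"
        unfolding j dist_norm by (rule approx_tail)
      also have "\<dots> = eta / 2 * (weight N \<lfloor>6^N * x\<rfloor> / 6^N)" by simp
      also have "\<dots> \<le> 1 * (weight N \<lfloor>6^N * x\<rfloor> / 6^N)"
        using weight_pos[of N "\<lfloor>6^N * x\<rfloor>"] by (intro mult_right_mono) (auto simp: eta_def)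
      also have "\<dots> = weight N \<lfloor>6^N * x\<rfloor> / 6^N" by simp
      also have "\<dots> \<le> (1/3)^N" by (rule weight_ratio_le)
      finally show ?thesis using N by simp
    qed
    then show "\<exists>N. \<forall>n\<ge>N. dist (approx n x) (approx N x) < e" by blast
  qed
  then show ?thesis unfolding curve_def by (intro convergent_LIMSEQ_iff[THEN iffD1] Cauchy_convergent)
qed

lemma curve_approx: "cmod (curve x - approx n x) \<le> eta * (weight n \<lfloor>6^n * x\<rfloor> / 6^n) / 2"
proof (rule LIMSEQ_le_const2)
  show "(\<lambda>j. cmod (approx (j + n) x - approx n x)) \<longlonglongrightarrow> cmod (curve x - approx n x)"
    by (intro tendsto_intros LIMSEQ_ignore_initial_segment approx_tendsto)
  show "\<exists>N. \<forall>j\<ge>N. cmod (approx (j + n) x - approx n x) \<le> eta * (weight n \<lfloor>6^n * x\<rfloor> / 6^n) / 2"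
  proof (intro exI allI impI)
    show "cmod (approx (j + n) x - approx n x) \<le> eta * (weight n \<lfloor>6^n * x\<rfloor> / 6^n) / 2" for j
      unfolding add.commute[of j n] by (rule approx_tail)
  qed
qed

lemma node_refine: "node (n + j) (6^j * k) = node n k"
proof (induction j)
  case (Suc j)
  have "(6 * 6^j * k) div 6 = 6^j * k" "(6 * 6^j * k) mod 6 = 0" by (simp_all add: mult.assoc)
  then show ?case using Suc by (simp add: psum_def)
qed simp

lemma curve_node: "curve (of_int k / 6^n) = node n k"
proof -
  have "approx (j + n) (of_int k / 6^n) = node n k" for j
  proof -
    have e: "6^(j + n) * (of_int k / 6^n) = (of_int (6^j * k) :: real)" by (simp add: power_add)
    have "(of_int k / 6^n :: real) - of_int (6^j * k) / 6^(j + n) = 0" by (simp add: power_add)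
    then show ?thesis unfolding approx_def e floor_of_int
      using node_refine[of n j k] by (simp add: add.commute)
  qed
  then have "(\<lambda>j. approx (j + n) (of_int k / 6^n)) \<longlonglongrightarrow> node n k" by simp
  moreover have "(\<lambda>j. approx (j + n) (of_int k / 6^n)) \<longlonglongrightarrow> curve (of_int k / 6^n)"
    by (intro LIMSEQ_ignore_initial_segment approx_tendsto)
  ultimately show ?thesis using LIMSEQ_unique by blast
qed

text \<open>A point within one cell length lies in the same or an adjacent cell \<open>q\<close>.
  The tail there costs eta/2 times a weight at most twice that of \<open>k\<close>. Replacing the
  slope of \<open>q\<close> by that of \<open>k\<close>, measured from the common node, costs 3 eta.
  Together 4 eta.\<close>

lemma curve_near_affine:
  assumes "\<bar>p - x\<bar> \<le> 1 / 6^n"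
  defines "k \<equiv> \<lfloor>6^n * x\<rfloor>"
  shows "cmod (curve p - (node n k + (p - of_int k / 6^n) *\<^sub>R slope n k)) \<le> 4 * eta * (weight n k / 6^n)"
proof -
  define L :: real where "L = 1 / 6^n"
  define q where "q = \<lfloor>6^n * p\<rfloor>"
  have L: "0 < L" by (simp add: L_def)
  have "\<bar>6^n * p - 6^n * x\<bar> \<le> 1"
  proof -
    have "\<bar>6^n * p - 6^n * x\<bar> = 6^n * \<bar>p - x\<bar>" by (simp add: abs_mult flip: right_diff_distrib)
    also have "\<dots> \<le> 6^n * (1 / 6^n)" using assms(1) by (intro mult_left_mono) auto
    finally show ?thesis by simp
  qed
  then have "q = k \<or> q = k + 1 \<or> q = k - 1" unfolding q_def k_def by linarith
  moreover have pq: "0 \<le> p - of_int q * L" "p - of_int q * L \<le> L"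
    using cell_bounds[of p n] by (auto simp: q_def L_def)
  have wk: "0 < weight n k" "0 < weight n q" by (rule weight_pos)+
  have cp: "cmod (curve p - (node n q + (p - of_int q * L) *\<^sub>R slope n q)) \<le> eta * (weight n q * L) / 2"
    using curve_approx[of p n] by (simp add: approx_def q_def L_def)
  have tri: "cmod (a - c) \<le> cmod (a - b) + cmod (b - c)" for a b c :: complex
    using norm_triangle_ineq[of "a - b" "b - c"] by simp
  have main: "cmod (curve p - (node n k + (p - of_int k * L) *\<^sub>R slope n k)) \<le> 4 * eta * (weight n k * L)"
    if s: "cmod (slope n q - slope n k) \<le> 3 * eta * weight n k"
      and d: "node n q + (p - of_int q * L) *\<^sub>R slope n q - (node n k + (p - of_int k * L) *\<^sub>R slope n k)
           = r *\<^sub>R (slope n q - slope n k)" "\<bar>r\<bar> \<le> L" for r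
  proof -
    have "weight n q - weight n k \<le> 3 * eta * weight n k"
      using s complex_Re_le_cmod[of "slope n q - slope n k"] by simp
    then have "weight n q \<le> 2 * weight n k" using wk by (simp add: eta_def)
    then have "eta * (weight n q * L) / 2 \<le> eta * (2 * weight n k * L) / 2"
      using L by (intro divide_right_mono mult_left_mono mult_right_mono) (auto simp: eta_def)
    moreover have "cmod (r *\<^sub>R (slope n q - slope n k)) \<le> L * (3 * eta * weight n k)"
      unfolding norm_scaleR using s d(2) by (intro mult_mono) auto
    moreover have "cmod (curve p - (node n k + (p - of_int k * L) *\<^sub>R slope n k)) \<le>
       cmod (curve p - (node n q + (p - of_int q * L) *\<^sub>R slope n q)) + cmod (r *\<^sub>R (slope n q - slope n k))"
      unfolding d(1)[symmetric] by (rule tri)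
    ultimately show ?thesis using cp by (simp add: algebra_simps)
  qed
  have inc: "node n (i + 1) = node n i + L *\<^sub>R slope n i" for i
    using node_increment[of n i] by (simp add: L_def scaleR_conv_of_real field_simps)
  have "cmod (curve p - (node n k + (p - of_int k * L) *\<^sub>R slope n k)) \<le> 4 * eta * (weight n k * L)"
    using \<open>q = k \<or> q = k + 1 \<or> q = k - 1\<close>
  proof (elim disjE)
    assume "q = k"
    then show ?thesis using main[of 0] L wk by (simp add: eta_def)
  next
    assume q: "q = k + 1"
    show ?thesis
    proof (rule main[of "p - of_int q * L"])
      show "cmod (slope n q - slope n k) \<le> 3 * eta * weight n k" using adjacent_slopes[of n k] q by simp
      show "node n q + (p - of_int q * L) *\<^sub>R slope n q - (node n k + (p - of_int k * L) *\<^sub>R slope n k)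
           = (p - of_int q * L) *\<^sub>R (slope n q - slope n k)"
        unfolding q inc by (simp add: algebra_simps)
    qed (use pq in simp)
  next
    assume q: "q = k - 1"
    then have k: "k = q + 1" by simp
    show ?thesis
    proof (rule main[of "p - of_int k * L"])
      show "cmod (slope n q - slope n k) \<le> 3 * eta * weight n k" using adjacent_slopes[of n q] k by (simp add: norm_minus_commute)
      show "node n q + (p - of_int q * L) *\<^sub>R slope n q - (node n k + (p - of_int k * L) *\<^sub>R slope n k)
           = (p - of_int k * L) *\<^sub>R (slope n q - slope n k)"
        unfolding k inc by (simp add: algebra_simps)
      show "\<bar>p - of_int k * L\<bar> \<le> L" using pq unfolding k by (simp add: algebra_simps abs_le_iff)
    qed
  qed
  then show ?thesis by (simp add: L_def)
qed

lemma continuous_curve: "continuous_on UNIV curve"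
  unfolding continuous_on_iff
proof (intro ballI allI impI)
  fix x e :: real assume "0 < e"
  then obtain n where n: "(1/3::real)^n < e / 2" using real_arch_pow_inv[of "e/2" "1/3"] by auto
  have "dist (curve p) (curve x) < e" if "dist p x < 1 / 6^n" for p
  proof -
    define k where "k = \<lfloor>6^n * x\<rfloor>"
    let ?l = "\<lambda>p. node n k + (p - of_int k / 6^n) *\<^sub>R slope n k"
    have a: "cmod (curve p - ?l p) \<le> 4 * eta * (weight n k / 6^n)"
      unfolding k_def by (rule curve_near_affine) (use that in \<open>simp add: dist_real_def\<close>)
    have b: "cmod (curve x - ?l x) \<le> 4 * eta * (weight n k / 6^n)"
      unfolding k_def by (rule curve_near_affine) simp
    have "?l p - ?l x = (p - x) *\<^sub>R slope n k" by (simp add: algebra_simps)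
    then have "cmod (?l p - ?l x) = \<bar>p - x\<bar> * cmod (slope n k)" by simp
    also have "\<dots> \<le> 1 / 6^n * 2^n" using that norm_slope_le[of n k]
      by (intro mult_mono) (auto simp: dist_real_def)
    also have "\<dots> = (2/6)^n" unfolding power_divide by simp
    finally have c: "cmod (?l p - ?l x) \<le> (1/3)^n" by simp
    have "curve p - curve x = (curve p - ?l p) - (curve x - ?l x) + (?l p - ?l x)" by simp
    then have "cmod (curve p - curve x) \<le> cmod ((curve p - ?l p) - (curve x - ?l x)) + cmod (?l p - ?l x)"
      using norm_triangle_ineq by metis
    then have "cmod (curve p - curve x) \<le> cmod (curve p - ?l p) + cmod (curve x - ?l x) + cmod (?l p - ?l x)"
      using norm_triangle_ineq4[of "curve p - ?l p" "curve x - ?l x"] by linarith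
    also have "\<dots> \<le> 8 * eta * (weight n k / 6^n) + (1/3)^n" using a b c by argo
    also have "8 * eta * (weight n k / 6^n) \<le> 1 * (weight n k / 6^n)"
      using weight_pos[of n k] by (intro mult_right_mono) (auto simp: eta_def)
    also have "\<dots> \<le> (1/3)^n" using weight_ratio_le[of n k] by simp
    finally show ?thesis using n by (simp add: dist_norm)
  qed
  moreover have "(0::real) < 1 / 6^n" by simp
  ultimately show "\<exists>d>0. \<forall>x'\<in>UNIV. dist x' x < d \<longrightarrow> dist (curve x') (curve x) < e" by blast
qed

lemma curve_near_identity: "cmod (curve x - of_real x) \<le> eta / 2"
  using curve_approx[of x 0] by (simp add: approx_def scaleR_conv_of_real)

lemma curve_zygmund:
  assumes "0 < t"
  shows "20 * cmod (curve (x + t) - 2 * curve x + curve (x - t)) \<le> Re (curve (x + t)) - Re (curve (x - t))"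
proof -
  \<comment> \<open>With error \<open>B\<close> at three points of an affine function of slope
    \<open>s\<close>, the second difference is at most 4 B and the real increment at least 2 t Re s
    - 2 B; hence 82 = 20 * 4 + 2.\<close>
  have *: "20 * cmod (curve (x + t) - 2 * curve x + curve (x - t)) \<le> Re (curve (x + t)) - Re (curve (x - t))"
    if b: "cmod (curve (x + t) - (A + (x + t) *\<^sub>R s)) \<le> B" "cmod (curve x - (A + x *\<^sub>R s)) \<le> B"
      "cmod (curve (x - t) - (A + (x - t) *\<^sub>R s)) \<le> B" "82 * B \<le> 2 * t * Re s" for A s B
  proof -
    define a where "a = curve (x + t) - (A + (x + t) *\<^sub>R s)"
    define b' where "b' = curve x - (A + x *\<^sub>R s)"
    define c where "c = curve (x - t) - (A + (x - t) *\<^sub>R s)"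
    have "curve (x + t) - 2 * curve x + curve (x - t) = a - 2 * b' + c"
      unfolding a_def b'_def c_def by (simp add: algebra_simps scaleR_conv_of_real)
    then have "cmod (curve (x + t) - 2 * curve x + curve (x - t)) \<le> cmod a + 2 * cmod b' + cmod c"
      using norm_triangle_ineq[of "a - 2 * b'" c] norm_triangle_ineq4[of a "2 * b'"] by (simp add: norm_mult)
    moreover have "Re (curve (x + t)) - Re (curve (x - t)) = 2 * t * Re s + Re a - Re c"
      unfolding a_def c_def by (simp add: algebra_simps)
    moreover have "- cmod a \<le> Re a" "Re c \<le> cmod c"
      using abs_Re_le_cmod[of a] abs_Re_le_cmod[of c] by linarith+
    ultimately show ?thesis using b unfolding a_def[symmetric] b'_def[symmetric] c_def[symmetric] by argo
  qed
  show ?thesis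
  proof (cases "t \<le> 1")
    case False
    then show ?thesis
      using curve_near_identity[of "x + t"] curve_near_identity[of x] curve_near_identity[of "x - t"]
      by (intro *[of 0 1 "eta/2"]) (simp_all add: eta_def scaleR_conv_of_real)
  next
    case True
    define P where "P n \<longleftrightarrow> t \<le> 1 / 6^n" for n :: nat
    have P0: "P 0" using True by (simp add: P_def)
    obtain N where "(1/6::real)^N < t" using real_arch_pow_inv[of t "1/6"] assms by auto
    then have "\<not> P N" by (simp add: P_def power_divide)
    with P0 obtain n where n: "P n" "\<not> P (Suc n)" using nat_induct[of P N] by blast
    define k where "k = \<lfloor>6^n * x\<rfloor>"
    define A where "A = node n k - (of_int k / 6^n) *\<^sub>R slope n k"
    have near: "cmod (curve p - (A + p *\<^sub>R slope n k)) \<le> 4 * eta * (weight n k / 6^n)"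
      if "\<bar>p - x\<bar> \<le> 1 / 6^n" for p
      using curve_near_affine[OF that] by (simp add: A_def k_def scaleR_diff_left algebra_simps)
    show ?thesis
    proof (rule *[of A "slope n k" "4 * eta * (weight n k / 6^n)"])
      \<comment> \<open>\<open>n\<close> is chosen with 6^(-n-1) < t \<le> 6^(-n), so a factor 6 is
        lost between the cell length and \<open>t\<close>; \<open>eta\<close> is small enough to pay
        for it.\<close>
      have "1 / 6^Suc n < t" using n(2) by (simp add: P_def)
      then have "1 / 6^n \<le> 6 * t" by (simp add: field_simps)
      then have "328 * eta * (weight n k * (1 / 6^n)) \<le> 328 * eta * (weight n k * (6 * t))"
        using weight_pos[of n k] by (intro mult_left_mono) (auto simp: eta_def)
      also have "\<dots> = 1968 / 1000 * (t * weight n k)" by (simp add: eta_def)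
      also have "\<dots> \<le> 2 * (t * weight n k)"
        using weight_pos[of n k] assms by (intro mult_right_mono) auto
      finally show "82 * (4 * eta * (weight n k / 6^n)) \<le> 2 * t * weight n k" by simp
    qed (rule near; use n(1) assms in \<open>simp add: P_def\<close>)+
  qed
qed

lemma curve_growth: "0 \<le> t \<Longrightarrow> t \<le> 1 \<Longrightarrow> cmod (curve (x + t) - curve x) \<le> 2"
proof -
  assume t: "0 \<le> t" "t \<le> 1"
  have "curve (x + t) - curve x = (curve (x + t) - of_real (x + t)) - (curve x - of_real x) + of_real t" by simp
  then have "cmod (curve (x + t) - curve x) \<le> cmod ((curve (x + t) - of_real (x + t)) - (curve x - of_real x)) + cmod (of_real t)"
    by (metis norm_triangle_ineq)
  also have "\<dots> \<le> cmod (curve (x + t) - of_real (x + t)) + cmod (curve x - of_real x) + t"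
    using norm_triangle_ineq4[of "curve (x + t) - of_real (x + t)" "curve x - of_real x"] t by simp
  also have "\<dots> \<le> 2" using curve_near_identity[of "x + t"] curve_near_identity[of x] t by (simp add: eta_def)
  finally show ?thesis .
qed

section \<open>Infinite variation\<close>

lemma second_difference_ge:
  fixes f :: "real \<Rightarrow> real"
  assumes h: "0 \<le> h"
    and f': "\<And>x. a - h \<le> x \<Longrightarrow> x \<le> a + h \<Longrightarrow> DERIV f x :> f' x"
    and f'': "\<And>x. a - h \<le> x \<Longrightarrow> x \<le> a + h \<Longrightarrow> DERIV f' x :> f'' x"
    and c: "\<And>x. a - h \<le> x \<Longrightarrow> x \<le> a + h \<Longrightarrow> c \<le> f'' x"
  shows "2 * f a + c * h\<^sup>2 \<le> f (a + h) + f (a - h)"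
proof -
  define g where "g x = f x - c / 2 * x\<^sup>2" for x
  have "convex_on {a - h..a + h} g"
  proof (rule f''_ge0_imp_convex)
    show "DERIV g x :> f' x - c * x" if "x \<in> {a - h..a + h}" for x
      unfolding g_def[abs_def] using that by (auto intro!: derivative_eq_intros f')
    show "DERIV (\<lambda>x. f' x - c * x) x :> f'' x - c" if "x \<in> {a - h..a + h}" for x
      using that by (auto intro!: derivative_eq_intros f'')
  qed (use c in auto)
  from convex_onD[OF this, of "1/2" "a - h" "a + h"] h
  have "g a \<le> (g (a - h) + g (a + h)) / 2" by (simp add: field_simps)
  then have "2 * g a \<le> g (a - h) + g (a + h)" by simp
  then show ?thesis unfolding g_def by (simp add: power2_eq_square algebra_simps)
qed

text \<open>The antiderivative of \<open>arctan\<close> that vanishes at 0, so its second derivative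
  is 1 / (1 + s^2).\<close>

definition entropy :: "real \<Rightarrow> real" where
  "entropy s = s * arctan s - ln (1 + s\<^sup>2) / 2"

text \<open>The potential is homogeneous of degree one with Laplacian \<open>1 / Re z\<close>. Hence an isotropic
  martingale step of size \<open>eta * Re z\<close> raises its mean by a multiple of \<open>Re z\<close>, while it
  remains bounded by a multiple of the norm.\<close>
definition potential :: "complex \<Rightarrow> real" where
  "potential z = Re z * entropy (Im z / Re z)"

lemma entropy_deriv: "DERIV entropy s :> arctan s"
proof -
  have p: "0 < 1 + s\<^sup>2" by (rule add_pos_nonneg) auto
  have "4 * s / (4 + s\<^sup>2 * 4) = (4 * s) / (4 * (1 + s\<^sup>2))" by (simp add: algebra_simps)
  also have "\<dots> = s / (1 + s\<^sup>2)" by (rule mult_divide_mult_cancel_left) simp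
  finally show ?thesis using p unfolding entropy_def[abs_def]
    by (auto intro!: derivative_eq_intros simp: inverse_eq_divide)
qed

text \<open>t * entropy (s / t) is the perspective of \<open>entropy\<close>, that is,
  \<open>potential\<close> along the horizontal line of height \<open>s\<close>.\<close>

lemma perspective_deriv:
  assumes "0 < t"
  shows "DERIV (\<lambda>t. t * entropy (s / t)) t :> - ln (1 + (s / t)\<^sup>2) / 2"
proof -
  have "DERIV (\<lambda>t. s / t) t :> - s / t\<^sup>2"
    using assms by (auto intro!: derivative_eq_intros simp: power2_eq_square)
  from DERIV_chain2[OF entropy_deriv this]
  have "DERIV (\<lambda>t. entropy (s / t)) t :> arctan (s / t) * (- s / t\<^sup>2)" .
  from DERIV_mult[OF DERIV_ident this]
  have "DERIV (\<lambda>t. t * entropy (s / t)) t :> 1 * entropy (s / t) + arctan (s / t) * (- s / t\<^sup>2) * t" .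
  moreover have "1 * entropy (s / t) + arctan (s / t) * (- s / t\<^sup>2) * t = - ln (1 + (s / t)\<^sup>2) / 2"
    using assms by (simp add: entropy_def power2_eq_square)
  ultimately show ?thesis by simp
qed

text \<open>The horizontal part of the Laplacian. Together with the vertical part t / (t^2 + s^2) it
  gives 1/t.\<close>

lemma perspective_deriv2:
  fixes s t :: real
  assumes "0 < t"
  shows "DERIV (\<lambda>t. - ln (1 + (s / t)\<^sup>2) / 2) t :> s\<^sup>2 / (t * (t\<^sup>2 + s\<^sup>2))"
proof -
  have p: "0 < 1 + (s / t)\<^sup>2" by (rule add_pos_nonneg) auto
  have e: "1 + (s / t)\<^sup>2 = (t\<^sup>2 + s\<^sup>2) / t\<^sup>2" using assms by (simp add: field_simps)
  have q: "t\<^sup>2 + s\<^sup>2 > 0" using assms by (simp add: add_pos_nonneg)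
  have "DERIV (\<lambda>t. - ln (1 + (s / t)\<^sup>2) / 2) t :> - (2 * (s / t) * (- s / t\<^sup>2)) / (1 + (s / t)\<^sup>2) / 2"
    using assms p by (auto intro!: derivative_eq_intros simp: power2_eq_square)
  moreover have "- (2 * (s / t) * (- s / t\<^sup>2)) / (1 + (s / t)\<^sup>2) / 2 = s\<^sup>2 / (t * (t\<^sup>2 + s\<^sup>2))"
  proof -
    have "- (2 * (s / t) * (- s / t\<^sup>2)) / (D / t\<^sup>2) / 2 = s\<^sup>2 / (t * D)" if "0 < D" for D
      using assms that by (simp add: field_simps power2_eq_square)
    from this[OF q] show ?thesis unfolding e .
  qed
  ultimately show ?thesis by simp
qed

text \<open>Neither direction gains uniformly: the vertical second derivative decays for large |s|,
  the horizontal one vanishes at s = 0. For |s| \<le> 1 the vertical pair gains at least h^2/5,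
  otherwise the horizontal pair at least h^2/10, and the other pair never loses by
  convexity.\<close>

lemma entropy_gain:
  assumes h: "0 < h" "h < 1"
  shows "4 * entropy s + h\<^sup>2 / 10 \<le> entropy (s + h) + entropy (s - h)
     + (1 + h) * entropy (s / (1 + h)) + (1 - h) * entropy (s / (1 - h))"
proof -
  have A: "2 * entropy s + c * h\<^sup>2 \<le> entropy (s + h) + entropy (s - h)"
    if "\<And>x. s - h \<le> x \<Longrightarrow> x \<le> s + h \<Longrightarrow> c \<le> 1 / (1 + x\<^sup>2)" for c
    by (rule second_difference_ge[OF _ entropy_deriv DERIV_arctan]) (use h that in \<open>auto simp: inverse_eq_divide\<close>)
  have B: "2 * entropy s + c * h\<^sup>2 \<le> (1 + h) * entropy (s / (1 + h)) + (1 - h) * entropy (s / (1 - h))"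
    if "\<And>t. 0 < t \<Longrightarrow> t \<le> 2 \<Longrightarrow> c \<le> s\<^sup>2 / (t * (t\<^sup>2 + s\<^sup>2))" for c
  proof -
    have "2 * (1 * entropy (s / 1)) + c * h\<^sup>2 \<le> (1 + h) * entropy (s / (1 + h)) + (1 - h) * entropy (s / (1 - h))"
      by (rule second_difference_ge[where f="\<lambda>t. t * entropy (s / t)", OF _ perspective_deriv perspective_deriv2])
        (use h that in auto)
    then show ?thesis by simp
  qed
  show ?thesis
  proof (cases "\<bar>s\<bar> \<le> 1")
    case True
    have "1/5 \<le> 1 / (1 + x\<^sup>2)" if "s - h \<le> x" "x \<le> s + h" for x
    proof -
      have "\<bar>x\<bar> \<le> 2" using that True h by linarith
      then have "x\<^sup>2 \<le> 2\<^sup>2" by (metis abs_ge_zero power2_abs power_mono)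
      then show ?thesis by (intro divide_left_mono) (auto simp: add_pos_nonneg)
    qed
    from A[OF this] have "2 * entropy s + 1/5 * h\<^sup>2 \<le> entropy (s + h) + entropy (s - h)" by blast
    moreover have "2 * entropy s + 0 * h\<^sup>2 \<le> (1 + h) * entropy (s / (1 + h)) + (1 - h) * entropy (s / (1 - h))"
      by (rule B) (intro divide_nonneg_nonneg mult_nonneg_nonneg add_nonneg_nonneg; simp)
    ultimately show ?thesis using zero_le_power2[of h] by argo
  next
    case False
    have s: "1 \<le> s\<^sup>2" using False one_le_power[of "\<bar>s\<bar>" 2] by simp
    have "1/10 \<le> s\<^sup>2 / (t * (t\<^sup>2 + s\<^sup>2))" if t: "0 < t" "t \<le> 2" for t
    proof -
      have "t * (t\<^sup>2 + s\<^sup>2) \<le> 2 * (2\<^sup>2 + s\<^sup>2)" using t power_mono[of t 2 2] by (intro mult_mono add_right_mono) auto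
      also have "\<dots> \<le> 10 * s\<^sup>2" using s by simp
      finally have 1: "t * (t\<^sup>2 + s\<^sup>2) \<le> 10 * s\<^sup>2" .
      have "0 < t * (t\<^sup>2 + s\<^sup>2)" using t by (simp add: add_pos_nonneg)
      with 1 show ?thesis by (simp add: pos_le_divide_eq)
    qed
    from B[OF this] have "2 * entropy s + 1/10 * h\<^sup>2 \<le> (1 + h) * entropy (s / (1 + h)) + (1 - h) * entropy (s / (1 - h))" by blast
    moreover have "2 * entropy s + 0 * h\<^sup>2 \<le> entropy (s + h) + entropy (s - h)"
      by (rule A) (simp add: add_pos_nonneg)
    ultimately show ?thesis by argo
  qed
qed

text \<open>\<open>arctan\<close> is bounded and the logarithm in \<open>entropy\<close> is
  subtracted with a nonnegative value, so \<open>entropy\<close> grows at most linearly.\<close>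

lemma potential_le: "0 < Re z \<Longrightarrow> potential z \<le> 2 * cmod z"
proof -
  assume w: "0 < Re z"
  have "\<bar>arctan s\<bar> \<le> 2" for s using arctan_bounded[of s] pi_less_4 by (simp add: abs_le_iff)
  then have "s * arctan s \<le> \<bar>s\<bar> * 2" for s
    using abs_ge_self[of "s * arctan s"] mult_left_mono[of "\<bar>arctan s\<bar>" 2 "\<bar>s\<bar>"] by (simp add: abs_mult)
  moreover have "0 \<le> ln (1 + s\<^sup>2)" for s :: real by (intro ln_ge_zero) simp
  ultimately have e: "entropy s \<le> 2 * \<bar>s\<bar>" for s
    unfolding entropy_def by (smt (verit) divide_nonneg_nonneg)
  have "potential z \<le> Re z * (2 * \<bar>Im z / Re z\<bar>)"
    unfolding potential_def using w by (intro mult_left_mono e) simp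
  also have "\<dots> = 2 * \<bar>Im z\<bar>" using w by simp
  also have "\<dots> \<le> 2 * cmod z" using abs_Im_le_cmod[of z] by simp
  finally show ?thesis .
qed

text \<open>Homogeneity divides out \<open>Re z\<close> and leaves the slope ratio \<open>s\<close>.
  The two neutral children contribute 2 entropy s, the other four are the terms of
  \<open>entropy_gain\<close>.\<close>

lemma potential_children:
  assumes w: "0 < Re z"
  shows "6 * potential z + eta\<^sup>2 / 10 * Re z \<le> (\<Sum>c<6. potential (z + of_real (Re z) * step (int c)))"
proof -
  define s where "s = Im z / Re z"
  have S: "Im z = Re z * s" using w by (simp add: s_def)
  have p: "potential (z + of_real (Re z) * d)
      = Re z * ((1 + Re d) * entropy ((s + Im d) / (1 + Re d)))" for d
  proof -
    have "Im (z + of_real (Re z) * d) / Re (z + of_real (Re z) * d) = (Re z * (s + Im d)) / (Re z * (1 + Re d))"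
      using S by (simp add: algebra_simps)
    also have "\<dots> = (s + Im d) / (1 + Re d)" using w by simp
    finally show ?thesis unfolding potential_def by (simp add: algebra_simps)
  qed
  have "(\<Sum>c<6. potential (z + of_real (Re z) * step (int c)))
     = Re z * (2 * entropy s + entropy (s + eta) + entropy (s - eta)
        + (1 + eta) * entropy (s / (1 + eta)) + (1 - eta) * entropy (s / (1 - eta)))"
    unfolding p by (simp add: eval_nat_numeral step_def algebra_simps)
  also have "\<dots> \<ge> Re z * (6 * entropy s + eta\<^sup>2 / 10)"
    using entropy_gain[of eta s] w by (intro mult_left_mono) (auto simp: eta_def)
  finally show ?thesis by (simp add: potential_def s_def algebra_simps)
qed

section \<open>Averages over one generation of cells\<close>

lemma sum_children:
  fixes f :: "complex \<Rightarrow> 'a::comm_monoid_add"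
  shows "(\<Sum>k<6^Suc n. f (slope (Suc n) (int k)))
    = (\<Sum>k<6^n. \<Sum>c<6. f (slope n (int k) + of_real (weight n (int k)) * step (int c)))"
proof -
  have "(\<Sum>k<6^Suc n. f (slope (Suc n) (int k))) = (\<Sum>k<6^n. \<Sum>j\<in>{k*6..<k*6+6}. f (slope (Suc n) (int j)))"
    using sum.nat_group[of "\<lambda>k. f (slope (Suc n) (int k))" 6 "6^n"] by (simp add: mult.commute)
  also have "\<dots> = (\<Sum>k<6^n. \<Sum>c<6. f (slope n (int k) + of_real (weight n (int k)) * step (int c)))"
  proof (rule sum.cong[OF refl])
    fix k :: nat
    have "(\<Sum>j\<in>{k*6..<k*6+6}. f (slope (Suc n) (int j))) = (\<Sum>c<6. f (slope (Suc n) (int (c + k * 6))))"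
      using sum.shift_bounds_nat_ivl[of "\<lambda>j. f (slope (Suc n) (int j))" 0 "k * 6" 6]
      by (simp add: add.commute lessThan_atLeast0)
    also have "\<dots> = (\<Sum>c<6. f (slope n (int k) + of_real (weight n (int k)) * step (int c)))"
      by (rule sum.cong) auto
    finally show "(\<Sum>j\<in>{k*6..<k*6+6}. f (slope (Suc n) (int j)))
      = (\<Sum>c<6. f (slope n (int k) + of_real (weight n (int k)) * step (int c)))" .
  qed
  finally show ?thesis .
qed

text \<open>The steps of the six children sum to 0, so the mean weight keeps its initial value
  1.\<close>

lemma sum_weight: "(\<Sum>k<6^n. weight n (int k)) = 6^n"
proof (induction n)
  case (Suc n)
  have "(\<Sum>c<6. Re (z + of_real (Re z) * step (int c))) = 6 * Re z" for z
    by (simp add: eval_nat_numeral step_def algebra_simps)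
  then have "(\<Sum>k<6^Suc n. weight (Suc n) (int k)) = 6 * (\<Sum>k<6^n. weight n (int k))"
    unfolding sum_children[of Re] sum_distrib_left by simp
  then show ?case using Suc by simp
qed simp

text \<open>The drift of a generation is eta^2/10 times the total weight 6^n; after normalisation by
  6^(n+1) every level adds eta^2/60.\<close>

lemma sum_potential: "real n * 6^n * (eta\<^sup>2 / 60) \<le> (\<Sum>k<6^n. potential (slope n (int k)))"
proof (induction n)
  case 0
  show ?case by (simp add: potential_def entropy_def)
next
  case (Suc n)
  have "real (Suc n) * 6^Suc n * (eta\<^sup>2 / 60) = 6 * (real n * 6^n * (eta\<^sup>2 / 60)) + eta\<^sup>2 / 10 * 6^n"
    by (simp add: algebra_simps)
  also have "\<dots> \<le> 6 * (\<Sum>k<6^n. potential (slope n (int k))) + eta\<^sup>2 / 10 * (\<Sum>k<6^n. weight n (int k))"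
    using Suc by (simp add: sum_weight mult_ac)
  also have "\<dots> = (\<Sum>k<6^n. 6 * potential (slope n (int k)) + eta\<^sup>2 / 10 * weight n (int k))"
    by (simp add: sum.distrib sum_distrib_left)
  also have "\<dots> \<le> (\<Sum>k<6^Suc n. potential (slope (Suc n) (int k)))"
    unfolding sum_children by (intro sum_mono potential_children weight_pos)
  finally show ?case .
qed

lemma sum_norm_slope: "real n * (eta\<^sup>2 / 120) \<le> (\<Sum>k<6^n. cmod (slope n (int k)) / 6^n)"
proof -
  have "real n * 6^n * (eta\<^sup>2 / 60) \<le> (\<Sum>k<6^n. 2 * cmod (slope n (int k)))"
    using sum_potential[of n] by (rule order_trans) (intro sum_mono potential_le weight_pos)
  also have "\<dots> = 2 * (\<Sum>k<6^n. cmod (slope n (int k)))" by (simp add: sum_distrib_left)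
  finally have "real n * (eta\<^sup>2 / 120) * 6^n \<le> (\<Sum>k<6^n. cmod (slope n (int k)))"
    by (simp add: mult_ac)
  then show ?thesis by (simp add: pos_le_divide_eq flip: sum_divide_distrib)
qed

section \<open>From lengths of inscribed polygons to \<Phi>-sums\<close>

lemma curve_increment: "cmod (curve (real (Suc k) / 6^n) - curve (real k / 6^n)) = cmod (slope n (int k)) / 6^n"
  using curve_node[of "int k + 1" n] curve_node[of "int k" n] node_increment[of n "int k"]
  by (simp add: norm_divide norm_power add.commute)

text \<open>Jensen for equal weights; monotonicity lets a lower bound \<open>T\<close> stand in for
  the sum itself.\<close>

lemma convex_sum_ge:
  fixes \<Phi> :: "real \<Rightarrow> real"
  assumes "convex_on {0..} \<Phi>" "mono_on {0..} \<Phi>" "0 < N" "\<And>j. j < N \<Longrightarrow> 0 \<le> t j"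
    "0 \<le> T" "T \<le> (\<Sum>j<N. t j)"
  shows "real N * \<Phi> (T / real N) \<le> (\<Sum>j<N. \<Phi> (t j))"
proof -
  have "\<Phi> (T / real N) \<le> \<Phi> ((\<Sum>j<N. t j) / real N)"
    using assms by (intro mono_onD[OF assms(2)]) (auto intro!: divide_right_mono sum_nonneg divide_nonneg_nonneg)
  also have "(\<Sum>j<N. t j) / real N = (\<Sum>j<N. (1 / real N) *\<^sub>R t j)" by (simp add: sum_divide_distrib)
  also have "\<Phi> \<dots> \<le> (\<Sum>j<N. 1 / real N * \<Phi> (t j))"
    using assms by (intro convex_on_sum[where C="{0..}"]) auto
  also have "\<dots> = (\<Sum>j<N. \<Phi> (t j)) / real N" by (simp add: sum_divide_distrib)
  finally show ?thesis using assms(3) by (simp add: pos_le_divide_eq mult.commute)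
qed

lemma curve_infinite_variation:
  assumes q: "0 < q" "q < 1" and \<Phi>: "Phi_q q \<Phi>"
  shows "\<not> finite_Phi_variation \<Phi> curve 0 1"
proof
  assume "finite_Phi_variation \<Phi> curve 0 1"
  then obtain B where B: "\<And>N x. N \<ge> 1 \<Longrightarrow> x 0 = 0 \<Longrightarrow> x N = 1 \<Longrightarrow> (\<forall>j<N. x j < x (Suc j)) \<Longrightarrow>
       (\<Sum>j<N. \<Phi> (cmod (curve (x (Suc j)) - curve (x j)))) \<le> B"
    unfolding finite_Phi_variation_def by blast
  from \<Phi> obtain \<delta> where cv: "convex_on {0..} \<Phi>" "mono_on {0..} \<Phi>"
    and d: "\<delta> > 0" "\<And>t. 0 < t \<Longrightarrow> t < \<delta> \<Longrightarrow> \<Phi> t = t / (ln (1 / t)) powr q"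
    unfolding Phi_q_def by blast
  define c :: real where "c = eta\<^sup>2 / 120"
  have c: "0 < c" by (simp add: c_def eta_def)
  have le: "6^n * \<Phi> (c * n / 6^n) \<le> B" for n :: nat
  proof -
    have "real (6^n) * \<Phi> (c * n / real (6^n)) \<le> (\<Sum>j<6^n. \<Phi> (cmod (slope n (int j)) / 6^n))"
      using sum_norm_slope[of n] c by (intro convex_sum_ge cv) (auto simp: c_def mult.commute)
    also have "\<dots> = (\<Sum>j<6^n. \<Phi> (cmod (curve (real (Suc j) / 6^n) - curve (real j / 6^n))))"
      unfolding curve_increment ..
    also have "\<dots> \<le> B" by (rule B) (auto intro!: divide_strict_right_mono)
    finally show ?thesis by simp
  qed
  have null: "(\<lambda>n. c * real n / 6^n) \<longlonglongrightarrow> 0" by real_asymp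
  have "\<forall>\<^sub>F n in sequentially. c * real n / 6^n < \<delta>"
    by (rule order_tendstoD(2)[OF null d(1)])
  moreover have "\<forall>\<^sub>F n in sequentially. c * real n / 6^n < 1"
    by (rule order_tendstoD(2)[OF null]) simp
  moreover have "\<forall>\<^sub>F n in sequentially. 1 \<le> c * real n"
    using c by real_asymp
  \<comment> \<open>The only place that uses q < 1: the quotient grows like n^(1-q).\<close>
  moreover have "\<forall>\<^sub>F n in sequentially. B < c * real n / (5 * real n) powr q"
  proof -
    have "filterlim (\<lambda>n. c * real n / (5 * real n) powr q) at_top sequentially"
      using c q by real_asymp
    then show ?thesis by (simp add: filterlim_at_top_dense)
  qed
  ultimately have "\<forall>\<^sub>F n in sequentially. False"
  proof eventually_elim
    case (elim n)
    let ?t = "c * real n / 6^n"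
    have t: "0 < ?t" using elim(3) by simp
    have n: "0 < real n" using elim(3) by (cases n) auto
    \<comment> \<open>1 / ?t = 6^n / (c n) is at most 6^n once c n \<ge> 1, so the logarithm is at
      most linear in \<open>n\<close>; the factor 5 is the crude bound ln 6 \<le> 6 - 1.\<close>
    have "ln (1 / ?t) \<le> ln (6^n)"
      using elim(3) by (intro ln_mono) (auto simp: field_simps)
    also have "\<dots> = real n * ln 6" by (simp add: ln_realpow)
    also have "\<dots> \<le> real n * 5"
      using ln_le_minus_one[of "6::real"] by (intro mult_left_mono) auto
    finally have l: "ln (1 / ?t) \<le> 5 * real n" by simp
    have "1 < 1 / ?t" using t elim(2) by (simp only: less_divide_eq_1_pos)
    then have l0: "0 < ln (1 / ?t)" by (rule ln_gt_zero)
    have "c * real n / (5 * real n) powr q \<le> c * real n / ln (1 / ?t) powr q"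
      using l l0 q n elim(3) by (intro divide_left_mono powr_mono2 mult_pos_pos) auto
    also have "\<dots> = 6^n * (?t / ln (1 / ?t) powr q)" by simp
    also have "\<dots> = 6^n * \<Phi> ?t" using d(2)[OF t elim(1)] by simp
    also have "\<dots> \<le> B" using le[of n] by simp
    finally show False using elim(4) by simp
  qed
  then show False by simp
qed

theorem theorem1p3:
  shows "\<exists>f. reduced_qc f \<and>
    (\<forall>q. 0 < q \<and> q < 1 \<longrightarrow>
       (\<forall>\<Phi>. Phi_q q \<Phi> \<longrightarrow> \<not> finite_Phi_variation \<Phi> (\<lambda>x. f (complex_of_real x)) 0 1))"
proof -
  interpret zygmund_curve curve 2
    by unfold_locales (fact continuous_curve curve_zygmund curve_growth)+
  have "curve 0 = 0" "curve 1 = 1" using curve_node[of 0 0] curve_node[of 1 0] by simp_all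
  then have "reduced_qc ext" using reduced_qc_ext[of 0 1] by simp
  moreover have "(\<lambda>x. ext (complex_of_real x)) = curve" by (simp add: ext_of_real)
  ultimately show ?thesis by (intro exI[of _ ext] conjI allI impI) (auto simp: curve_infinite_variation)
qed

end
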